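(* Up to isomorphism, there are exactly $6$ abelian groups among the groups generated by $3$-state invertible automata over a $2$-letter alphabet: the trivial group $\{1\}$ (generated by $\mathcal A_{1}$), $C_2$ (generated by $\mathcal A_{1090}$), $C_2\times C_2$ (generated by $\mathcal A_{730}$), $C_2\times C_2\times C_2$ (generated by $\mathcal A_{802}$), $\mathbb Z$ (generated by $\mathcal A_{731}$) and $\mathbb Z^2$ (generated by $\mathcal A_{771}$).
   Context: Let $X=\{0,1\}$ and let $X^*$ be the set of finite words over $X$, viewed as the rooted binary tree. An invertible automaton $A$ with $3$ states $1,2,3$ over $X$ is given by a system $q=\sigma^{a_{q1}}(a_{q2},a_{q3})$, $q=1,2,3$, where $a_{q1}\in\{0,1\}$, $a_{q2},a_{q3}\in\{1,2,3\}$ and $\sigma$ is the transposition $(01)$ of $X$. Each state $q$ defines an automorphism of the tree $X^*$, recursively by $q(\emptyset)=\emptyset$, $q(0w)=\sigma^{a_{q1}}(0)\,a_{q2}(w)$ and $q(1w)=\sigma^{a_{q1}}(1)\,a_{q3}(w)$ for all $w\in X^*$. The automaton group $G(A)$ is the subgroup of $\mathrm{Aut}(X^* )$ generated by the three states. The automaton is assigned the number $$(a_{12}-1)+3(a_{13}-1)+9(a_{22}-1)+27(a_{23}-1)+81(a_{32}-1)+243(a_{33}-1)+729(a_{11}+2a_{21}+4a_{31})+1,$$ and $\mathcal A_n$ denotes the automaton with number $n$, $1\le n\le 5832$. $C_2$ is the cyclic group of order $2$. *)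

theory Defs
  imports "HOL-Algebra.Algebra" "HOL-Library.Cardinality"
begin

datatype state = S1 | S2 | S3

primrec index :: "state \<Rightarrow> nat" where
  "index S1 = 1"
| "index S2 = 2"
| "index S3 = 3"

text \<open>
  The two letters are \<^term>\<open>False\<close> (for 0) and \<^term>\<open>True\<close> (for 1). An invertible automaton
  maps each state \<open>q\<close> to \<open>(a\<^sub>q\<^sub>1, a\<^sub>q\<^sub>2, a\<^sub>q\<^sub>3)\<close>, where \<open>a\<^sub>q\<^sub>1\<close> says whether \<open>q\<close> acts on the first
  letter by the transposition, and \<open>a\<^sub>q\<^sub>2\<close>, \<open>a\<^sub>q\<^sub>3\<close> are the states reached after reading 0 and 1.
\<close>
type_synonym letter = bool
type_synonym automaton = "state \<Rightarrow> bool \<times> state \<times> state"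

definition swaps :: "automaton \<Rightarrow> state \<Rightarrow> bool" where
  "swaps A q = fst (A q)"

definition next0 :: "automaton \<Rightarrow> state \<Rightarrow> state" where
  "next0 A q = fst (snd (A q))"

definition next1 :: "automaton \<Rightarrow> state \<Rightarrow> state" where
  "next1 A q = snd (snd (A q))"

definition sigma :: "letter \<Rightarrow> letter" where
  "sigma = transpose False True"

fun act :: "automaton \<Rightarrow> state \<Rightarrow> letter list \<Rightarrow> letter list" where
  "act A q [] = []"
| "act A q (False # w) = (sigma ^^ of_bool (swaps A q)) False # act A (next0 A q) w"
| "act A q (True # w) = (sigma ^^ of_bool (swaps A q)) True # act A (next1 A q) w"

definition adjacent :: "letter list \<Rightarrow> letter list \<Rightarrow> bool" where
  "adjacent u v \<longleftrightarrow> (\<exists>x. v = u @ [x] \<or> u = v @ [x])"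

text \<open>The automorphism group of the binary tree on all words, rooted at the empty word.\<close>
definition tree_Aut :: "(letter list \<Rightarrow> letter list) monoid" where
  "tree_Aut = BijGroup UNIV
     \<lparr>carrier := {f. bij f \<and> f [] = [] \<and> (\<forall>u v. adjacent (f u) (f v) \<longleftrightarrow> adjacent u v)}\<rparr>"

text \<open>
  \<^const>\<open>subgroup_generated\<close> intersects the generators with the carrier; this discards nothing
  here, by \<open>act_in_tree_Aut\<close> below.
\<close>
definition automaton_group :: "automaton \<Rightarrow> (letter list \<Rightarrow> letter list) monoid" where
  "automaton_group A = subgroup_generated tree_Aut (range (act A))"

definition automaton_number :: "automaton \<Rightarrow> nat" where
  "automaton_number A =
     (index (next0 A S1) - 1) + 3 * (index (next1 A S1) - 1)
     + 9 * (index (next0 A S2) - 1) + 27 * (index (next1 A S2) - 1)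
     + 81 * (index (next0 A S3) - 1) + 243 * (index (next1 A S3) - 1)
     + 729 * (of_bool (swaps A S1) + 2 * of_bool (swaps A S2) + 4 * of_bool (swaps A S3)) + 1"

text \<open>Meaningful for \<open>1 \<le> n \<le> 5832\<close>; see \<open>bij_betw_automaton_number\<close> below.\<close>
definition numbered_automaton :: "nat \<Rightarrow> automaton" where
  "numbered_automaton n = (THE A. automaton_number A = n)"

definition isomorphic_group_rel :: "(automaton \<times> automaton) set" where
  "isomorphic_group_rel = {(A, B). automaton_group A \<cong> automaton_group B}"

lemma index_minus_1_less: "index q - 1 < 3"
  by (cases q) auto

lemma index_minus_1_inject: "index p - 1 = index q - 1 \<longleftrightarrow> p = q"
  by (cases p; cases q) auto

lemma mixed_radix_inject:
  fixes a b c d e f g :: nat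
  assumes "a < 3" "b < 3" "c < 3" "d < 3" "e < 3" "f < 3"
    and "a' < 3" "b' < 3" "c' < 3" "d' < 3" "e' < 3" "f' < 3"
    and "a + 3 * b + 9 * c + 27 * d + 81 * e + 243 * f + 729 * g
       = a' + 3 * b' + 9 * c' + 27 * d' + 81 * e' + 243 * f' + 729 * g'"
  shows "a = a' \<and> b = b' \<and> c = c' \<and> d = d' \<and> e = e' \<and> f = f' \<and> g = g'"
proof -
  have step: "x = x' \<and> y = y'" if "x < 3" "x' < 3" "x + 3 * y = x' + 3 * y'" for x x' y y' :: nat
    using that by presburger
  have "a = a' \<and> b + 3 * (c + 3 * (d + 3 * (e + 3 * (f + 3 * g))))
                = b' + 3 * (c' + 3 * (d' + 3 * (e' + 3 * (f' + 3 * g'))))"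
    by (rule step) (use assms in auto)
  with assms step show ?thesis by metis
qed

lemma inj_automaton_number: "inj automaton_number"
proof (rule injI)
  fix A B :: automaton
  assume "automaton_number A = automaton_number B"
  then have *: "next0 A S1 = next0 B S1 \<and> next1 A S1 = next1 B S1
      \<and> next0 A S2 = next0 B S2 \<and> next1 A S2 = next1 B S2
      \<and> next0 A S3 = next0 B S3 \<and> next1 A S3 = next1 B S3
      \<and> of_bool (swaps A S1) + 2 * of_bool (swaps A S2) + 4 * of_bool (swaps A S3)
        = (of_bool (swaps B S1) + 2 * of_bool (swaps B S2) + 4 * of_bool (swaps B S3) :: nat)"
    unfolding automaton_number_def
    using mixed_radix_inject[OF index_minus_1_less index_minus_1_less index_minus_1_less
        index_minus_1_less index_minus_1_less index_minus_1_less index_minus_1_less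
        index_minus_1_less index_minus_1_less index_minus_1_less index_minus_1_less
        index_minus_1_less]
    by (simp only: index_minus_1_inject add_right_cancel)
  then have "swaps A S1 = swaps B S1 \<and> swaps A S2 = swaps B S2 \<and> swaps A S3 = swaps B S3"
    by (auto simp: of_bool_def split: if_splits)
  with * have "A q = B q" for q
    by (cases q) (auto simp: swaps_def next0_def next1_def prod_eq_iff)
  then show "A = B" by blast
qed

lemma UNIV_state: "UNIV = {S1, S2, S3}"
  using state.exhaust by auto

instance state :: finite
  by standard (simp add: UNIV_state)

lemma bij_betw_automaton_number: "bij_betw automaton_number UNIV {1..5832}"
proof -
  have card: "card (UNIV :: automaton set) = 5832"
  proof -
    have 3: "card (UNIV :: state set) = 3" by (simp add: UNIV_state)
    have "card (UNIV :: (bool \<times> state \<times> state) set) = 18"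
      by (simp add: 3)
    then show ?thesis by (simp add: card_fun 3)
  qed
  have "automaton_number A \<in> {1..5832}" for A
    using index_minus_1_less[of "next0 A S1"] index_minus_1_less[of "next1 A S1"]
      index_minus_1_less[of "next0 A S2"] index_minus_1_less[of "next1 A S2"]
      index_minus_1_less[of "next0 A S3"] index_minus_1_less[of "next1 A S3"]
    by (auto simp: automaton_number_def of_bool_def)
  then have "range automaton_number \<subseteq> {1..5832}" by blast
  moreover have "card (range automaton_number) = card {1..5832::nat}"
    using card_image[OF inj_automaton_number] card by simp
  ultimately have "range automaton_number = {1..5832}"
    by (intro card_subset_eq) auto
  then show ?thesis using inj_automaton_number by (simp add: bij_betw_def)
qed

lemma automaton_number_numbered_automaton:
  assumes "1 \<le> n" "n \<le> 5832"
  shows "automaton_number (numbered_automaton n) = n"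
proof -
  obtain A where "automaton_number A = n"
    using assms bij_betw_imp_surj_on[OF bij_betw_automaton_number]
    by (metis atLeastAtMost_iff imageE)
  then show ?thesis
    unfolding numbered_automaton_def
    by (metis (mono_tags, lifting) inj_automaton_number injD theI)
qed

lemma carrier_tree_Aut:
  "carrier tree_Aut = {f. bij f \<and> f [] = [] \<and> (\<forall>u v. adjacent (f u) (f v) \<longleftrightarrow> adjacent u v)}"
  by (simp add: tree_Aut_def)

lemma group_tree_Aut: "group tree_Aut"
proof -
  have "subgroup (carrier tree_Aut) (BijGroup UNIV)"
  proof (rule group.subgroupI[OF group_BijGroup])
    show "carrier tree_Aut \<subseteq> carrier (BijGroup UNIV)"
      by (auto simp: carrier_tree_Aut BijGroup_def Bij_def)
    have "id \<in> carrier tree_Aut" by (simp add: carrier_tree_Aut)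
    then show "carrier tree_Aut \<noteq> {}" by blast
  next
    fix f assume f: "f \<in> carrier tree_Aut"
    then have "bij f" by (simp add: carrier_tree_Aut)
    then have "inv\<^bsub>BijGroup UNIV\<^esub> f = inv_into UNIV f"
      by (subst inv_BijGroup) (auto simp: Bij_def)
    moreover have "inv_into UNIV f \<in> carrier tree_Aut"
      using f \<open>bij f\<close> unfolding carrier_tree_Aut
      by (auto simp: bij_imp_bij_inv inv_f_eq bij_is_inj) (metis bij_inv_eq_iff)+
    ultimately show "inv\<^bsub>BijGroup UNIV\<^esub> f \<in> carrier tree_Aut" by simp
  next
    fix f g assume "f \<in> carrier tree_Aut" "g \<in> carrier tree_Aut"
    then show "f \<otimes>\<^bsub>BijGroup UNIV\<^esub> g \<in> carrier tree_Aut"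
      by (auto simp: carrier_tree_Aut BijGroup_def Bij_def compose_def bij_comp[unfolded comp_def])
  qed
  then show ?thesis
    using group.subgroup_imp_group[OF group_BijGroup] by (fastforce simp: tree_Aut_def)
qed

lemma act_Cons:
  "act A q (x # w) = (x \<noteq> swaps A q) # act A (if x then next1 A q else next0 A q) w"
  by (cases x) (auto simp: sigma_def)

lemma length_act: "length (act A q w) = length w"
  by (induction w arbitrary: q) (auto simp: act_Cons)

lemma inj_act: "act A q u = act A q v \<Longrightarrow> u = v"
proof (induction u arbitrary: q v)
  case Nil
  then show ?case by (metis act.simps(1) length_0_conv length_act)
next
  case (Cons x u)
  then obtain y v' where v: "v = y # v'"
    by (metis act_Cons length_0_conv length_act list.exhaust list.simps(3))
  then show ?case using Cons by (cases "x = y") (auto simp: act_Cons)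
qed

lemma surj_act: "\<exists>u. act A q u = v"
proof (induction v arbitrary: q)
  case Nil
  then show ?case by (metis act.simps(1))
next
  case (Cons y v)
  obtain u where "act A (if y \<noteq> swaps A q then next1 A q else next0 A q) u = v"
    using Cons by blast
  then have "act A q ((y \<noteq> swaps A q) # u) = y # v" by (auto simp: act_Cons)
  then show ?case by blast
qed

lemma act_snoc: "\<exists>y. act A q (w @ [x]) = act A q w @ [y]"
  by (induction w arbitrary: q) (auto simp: act_Cons)

lemma act_snoc_iff: "(\<exists>x. act A q v = act A q u @ [x]) \<longleftrightarrow> (\<exists>x. v = u @ [x])"
proof
  assume "\<exists>x. act A q v = act A q u @ [x]"
  then obtain x where x: "act A q v = act A q u @ [x]" by blast
  then have "v \<noteq> []" by (metis act.simps(1) snoc_eq_iff_butlast)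
  then obtain v' y where v: "v = v' @ [y]" by (metis rev_exhaust)
  then obtain z where "act A q v = act A q v' @ [z]" using act_snoc by blast
  with x have "act A q v' = act A q u" by simp
  then have "v' = u" by (rule inj_act)
  with v show "\<exists>x. v = u @ [x]" by blast
qed (use act_snoc in blast)

lemma act_in_tree_Aut: "act A q \<in> carrier tree_Aut"
proof -
  have "bij (act A q)"
    unfolding bij_def surj_def inj_def by (metis inj_act surj_act)
  moreover have "adjacent (act A q u) (act A q v) \<longleftrightarrow> adjacent u v" for u v
    unfolding adjacent_def using act_snoc_iff by (metis (no_types))
  ultimately show ?thesis by (simp add: carrier_tree_Aut)
qed

end

theory Submission
  imports Defs
begin

text \<open>
  Let \<open>G\<close> be a commutative automaton group. Commutativity forces the two sections of an inactive
  element (one fixing the letters) to be equal, and the quotient \<open>\<delta>\<close> of the two sections of an active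
  element not to depend on that element. If \<open>\<delta> = 1\<close> then \<open>G\<close> has exponent 2; otherwise \<open>G\<close> is torsion-free.
  In the torsion-free case the stationary measure of the random walk on the three states is the
  exponent vector of an element \<open>g\<close> such that both sections of \<open>g\<^sup>2\<close> are \<open>g\<^sup>2\<close>. Hence \<open>g = 1\<close>, a
  nontrivial relation between the three generators, and \<open>G\<close> is free abelian of rank at most 2.
\<close>

section \<open>Abelian groups of exponent 2 and torsion-free ones\<close>

text \<open>No automata are enumerated: the classification rests on self-similarity alone, and only
  the six named automata are computed. Triviality of elements is proved by one coinductive
  principle: a set of inactive elements that is closed under sections contains at most the identity.
  The work lies in guessing such sets: squares, involutions, \<open>k\<close>-torsion for odd
  \<open>k\<close>, a singleton. Both branches share a modulus \<open>m\<close>, with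
  \<open>m = 2\<close> for exponent 2 and \<open>m = 0\<close> for torsion-free, since
  \<open>integer_mod_group 0\<close> is the group of integers. A relation whose exponents are not
  all divisible by \<open>m\<close> makes a generator redundant. For \<open>m = 2\<close> three
  independent generators do occur; for \<open>m = 0\<close> they must be excluded, although no
  relation is visible in the automaton. Linear algebra supplies it: multiplying the two sections of
  an element is an endomorphism, and on exponent vectors it is the matrix that counts transitions.
  Its rows sum to 2, so 2 is an eigenvalue, and an integral row eigenvector is the wanted
  relation.\<close>

lemma (in group) int_pow_mod_exponent:
  fixes i m :: int
  assumes "u \<in> carrier G" "u [^] m = \<one>"
  shows "u [^] (i mod m) = u [^] i"
proof -
  have "u [^] i = u [^] (m * (i div m) + i mod m)" by simp
  also have "\<dots> = (u [^] m) [^] (i div m) \<otimes> u [^] (i mod m)"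
    using assms(1) by (simp only: int_pow_mult int_pow_pow)
  finally show ?thesis using assms by simp
qed

lemma (in group) int_pow_hom_integer_mod_group:
  assumes "u \<in> carrier G" "u [^] int m = \<one>"
  shows "(\<lambda>i::int. u [^] i) \<in> hom (integer_mod_group m) G"
  using assms by (auto simp: hom_def int_pow_mod_exponent int_pow_mult)

lemma zero_if_in_integer_mod_group:
  assumes "i \<in> carrier (integer_mod_group m)" "int m dvd i"
  shows "i = 0"
  using assms zdvd_not_zless[of i "int m"]
  by (cases "i = 0") (auto simp: carrier_integer_mod_group split: if_splits)

text \<open>Divisibility by \<open>int m\<close> is the form of independence that serves both
  moduli: for \<open>m = 0\<close> it says that the exponent is 0, and the assumption
  \<open>exponent\<close> becomes vacuous. The versions for two and three generators follow the same
  pattern.\<close>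

lemma (in comm_group) iso_integer_mod_group_1:
  assumes u: "u \<in> carrier G"
    and exponent: "u [^] int m = \<one>"
    and gen: "\<forall>g \<in> carrier G. \<exists>i::int. g = u [^] i"
    and indep: "\<And>i::int. u [^] i = \<one> \<Longrightarrow> int m dvd i"
  shows "G \<cong> integer_mod_group m"
proof -
  let ?h = "\<lambda>i::int. u [^] i"
  have hom: "?h \<in> hom (integer_mod_group m) G"
    by (rule int_pow_hom_integer_mod_group) fact+
  interpret h: group_hom "integer_mod_group m" G ?h
    by (simp add: group_hom_def group_hom_axioms_def is_group hom)
  have "?h \<in> iso (integer_mod_group m) G"
    unfolding h.iso_iff
  proof (intro conjI subsetI ballI impI)
    fix g assume "g \<in> carrier G"
    then obtain i :: int where "g = u [^] i" using gen by blast
    then have "g = ?h (i mod int m)" using u exponent by (simp add: int_pow_mod_exponent)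
    moreover have "i mod int m \<in> carrier (integer_mod_group m)"
      by (simp add: carrier_integer_mod_group)
    ultimately show "g \<in> ?h ` carrier (integer_mod_group m)" by blast
  next
    fix i assume "i \<in> carrier (integer_mod_group m)" "?h i = \<one>"
    then show "i = \<one>\<^bsub>integer_mod_group m\<^esub>"
      using indep[of i] by (simp add: zero_if_in_integer_mod_group)
  qed
  then show ?thesis
    by (rule group.iso_sym[OF group_integer_mod_group is_isoI])
qed

lemma (in comm_group) iso_integer_mod_group_2:
  assumes uv: "u \<in> carrier G" "v \<in> carrier G"
    and exponent: "u [^] int m = \<one>" "v [^] int m = \<one>"
    and gen: "\<forall>g \<in> carrier G. \<exists>(i::int) (j::int). g = u [^] i \<otimes> v [^] j"
    and indep: "\<And>(i::int) (j::int). u [^] i \<otimes> v [^] j = \<one> \<Longrightarrow> int m dvd i \<and> int m dvd j"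
  shows "G \<cong> integer_mod_group m \<times>\<times> integer_mod_group m"
proof -
  let ?Z = "integer_mod_group m"
  let ?h = "\<lambda>x. u [^] fst x \<otimes> v [^] (snd x :: int)"
  have hom: "?h \<in> hom (?Z \<times>\<times> ?Z) G"
    using uv exponent
    by (auto simp: hom_def int_pow_mod_exponent int_pow_mult m_ac)
  interpret h: group_hom "?Z \<times>\<times> ?Z" G ?h
    by (simp add: group_hom_def group_hom_axioms_def is_group hom DirProd_group)
  have "?h \<in> iso (?Z \<times>\<times> ?Z) G"
    unfolding h.iso_iff
  proof (intro conjI subsetI ballI impI)
    fix g assume "g \<in> carrier G"
    then obtain i j :: int where "g = u [^] i \<otimes> v [^] j" using gen by blast
    then have "g = ?h (i mod int m, j mod int m)"
      using uv exponent by (simp add: int_pow_mod_exponent)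
    moreover have "(i mod int m, j mod int m) \<in> carrier (?Z \<times>\<times> ?Z)"
      by (simp add: carrier_integer_mod_group)
    ultimately show "g \<in> ?h ` carrier (?Z \<times>\<times> ?Z)" by blast
  next
    fix x assume x: "x \<in> carrier (?Z \<times>\<times> ?Z)" and "?h x = \<one>"
    then have "int m dvd fst x \<and> int m dvd snd x" using indep by blast
    then show "x = \<one>\<^bsub>?Z \<times>\<times> ?Z\<^esub>"
      using x by (cases x) (auto simp: zero_if_in_integer_mod_group)
  qed
  then show ?thesis
    by (intro group.iso_sym[OF _ is_isoI] DirProd_group group_integer_mod_group)
qed

lemma (in comm_group) iso_integer_mod_group_3:
  assumes uvw: "u \<in> carrier G" "v \<in> carrier G" "w \<in> carrier G"
    and exponent: "u [^] int m = \<one>" "v [^] int m = \<one>" "w [^] int m = \<one>"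
    and gen: "\<forall>g \<in> carrier G. \<exists>(i::int) (j::int) (k::int). g = u [^] i \<otimes> (v [^] j \<otimes> w [^] k)"
    and indep: "\<And>(i::int) (j::int) (k::int). u [^] i \<otimes> (v [^] j \<otimes> w [^] k) = \<one>
      \<Longrightarrow> int m dvd i \<and> int m dvd j \<and> int m dvd k"
  shows "G \<cong> integer_mod_group m \<times>\<times> integer_mod_group m \<times>\<times> integer_mod_group m"
proof -
  let ?Z = "integer_mod_group m"
  let ?h = "\<lambda>x. u [^] fst x \<otimes> (v [^] fst (snd x) \<otimes> w [^] (snd (snd x) :: int))"
  have hom: "?h \<in> hom (?Z \<times>\<times> ?Z \<times>\<times> ?Z) G"
    using uvw exponent
    by (auto simp: hom_def int_pow_mod_exponent int_pow_mult m_ac)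
  interpret h: group_hom "?Z \<times>\<times> ?Z \<times>\<times> ?Z" G ?h
    by (simp add: group_hom_def group_hom_axioms_def is_group hom DirProd_group)
  have "?h \<in> iso (?Z \<times>\<times> ?Z \<times>\<times> ?Z) G"
    unfolding h.iso_iff
  proof (intro conjI subsetI ballI impI)
    fix g assume "g \<in> carrier G"
    then obtain i j k :: int where "g = u [^] i \<otimes> (v [^] j \<otimes> w [^] k)" using gen by blast
    then have "g = ?h (i mod int m, j mod int m, k mod int m)"
      using uvw exponent by (simp add: int_pow_mod_exponent)
    moreover have "(i mod int m, j mod int m, k mod int m) \<in> carrier (?Z \<times>\<times> ?Z \<times>\<times> ?Z)"
      by (simp add: carrier_integer_mod_group)
    ultimately show "g \<in> ?h ` carrier (?Z \<times>\<times> ?Z \<times>\<times> ?Z)" by blast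
  next
    fix x assume x: "x \<in> carrier (?Z \<times>\<times> ?Z \<times>\<times> ?Z)" and "?h x = \<one>"
    then have "int m dvd fst x \<and> int m dvd fst (snd x) \<and> int m dvd snd (snd x)" using indep by blast
    then show "x = \<one>\<^bsub>?Z \<times>\<times> ?Z \<times>\<times> ?Z\<^esub>"
      using x by (cases x) (auto simp: zero_if_in_integer_mod_group)
  qed
  then show ?thesis
    by (intro group.iso_sym[OF _ is_isoI] DirProd_group group_integer_mod_group)
qed

section \<open>Eliminating a generator by means of a nontrivial relation\<close>

lemma (in comm_group) int_pow_combine:
  fixes i j i' j' :: int
  assumes "u \<in> carrier G" "v \<in> carrier G"
  shows "(u [^] i \<otimes> v [^] j) \<otimes> (u [^] i' \<otimes> v [^] j') = u [^] (i + i') \<otimes> v [^] (j + j')"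
    and "(u [^] i \<otimes> v [^] j) [^] (i'::int) = u [^] (i * i') \<otimes> v [^] (j * i')"
  using assms by (simp_all add: int_pow_mult int_pow_distrib int_pow_pow m_ac)

text \<open>
  With Bezout coefficients for the exponents, \<open>s\<close> and \<open>t\<close> are the images of \<open>u\<close> and \<open>v\<close> under a
  unimodular change of basis.
\<close>

lemma (in comm_group) unimodular_change_of_generators:
  fixes i j :: int
  assumes uv: "u \<in> carrier G" "v \<in> carrier G" and "(i, j) \<noteq> (0, 0)"
  obtains s t and a b c d :: int where "s \<in> carrier G" "t \<in> carrier G"
    "u = s [^] a \<otimes> t [^] b" "v = s [^] c \<otimes> t [^] d"
    "t [^] gcd i j = u [^] i \<otimes> v [^] j"
proof -
  define x where "x = i div gcd i j"
  define y where "y = j div gcd i j"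
  have g: "gcd i j \<noteq> 0" using assms by auto
  have i: "x * gcd i j = i" and j: "y * gcd i j = j" by (simp_all add: x_def y_def)
  obtain p q where pq: "p * i + q * j = gcd i j" using bezout_int by blast
  have "(p * x + q * y) * gcd i j = 1 * gcd i j"
    using pq i j by (metis distrib_right mult.assoc mult_1)
  then have det: "p * x + q * y = 1" using g by (metis mult_right_cancel)
  define s where "s = u [^] q \<otimes> v [^] (- p)"
  define t where "t = u [^] x \<otimes> v [^] y"
  have st: "s [^] k \<otimes> t [^] l = u [^] (q * k + x * l) \<otimes> v [^] (- p * k + y * l)" for k l :: int
    using uv by (simp only: s_def t_def int_pow_combine)
  show ?thesis
  proof
    show "s \<in> carrier G" "t \<in> carrier G" using uv by (simp_all add: s_def t_def)
    have "q * y + x * p = 1" "- p * y + y * p = 0" using det by (simp_all add: algebra_simps)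
    then show "u = s [^] y \<otimes> t [^] p" using uv by (simp only: st) simp
    have "q * - x + x * q = 0" "- p * - x + y * q = 1" using det by (simp_all add: algebra_simps)
    then show "v = s [^] (- x) \<otimes> t [^] q" using uv by (simp only: st) simp
    show "t [^] gcd i j = u [^] i \<otimes> v [^] j"
      using uv by (simp only: t_def int_pow_combine i j)
  qed
qed

text \<open>In the new basis the relation is a pure power of \<open>t\<close> with exponent
  \<open>gcd i j\<close>, which \<open>m\<close> does not divide; so \<open>t\<close> is trivial and
  \<open>s\<close> alone remains. The assumption \<open>torsion\<close> covers torsion-free groups
  (\<open>m = 0\<close>) as well as groups of prime exponent \<open>m\<close>.\<close>

lemma (in comm_group) relation_2_imp_cyclic:
  fixes m i j :: int
  assumes uv: "u \<in> carrier G" "v \<in> carrier G"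
    and torsion: "\<forall>g \<in> carrier G. \<forall>k::int. g [^] k = \<one> \<longrightarrow> m dvd k \<or> g = \<one>"
    and rel: "u [^] i \<otimes> v [^] j = \<one>" and nontrivial: "\<not> (m dvd i \<and> m dvd j)"
  obtains w and a b :: int where "w \<in> carrier G" "u = w [^] a" "v = w [^] b"
proof -
  have "(i, j) \<noteq> (0, 0)" using nontrivial by auto
  then obtain s t and a b c d :: int where st: "s \<in> carrier G" "t \<in> carrier G"
    "u = s [^] a \<otimes> t [^] b" "v = s [^] c \<otimes> t [^] d" "t [^] gcd i j = u [^] i \<otimes> v [^] j"
    using unimodular_change_of_generators uv by metis
  moreover have "\<not> m dvd gcd i j" using nontrivial by simp
  ultimately have "t = \<one>" using torsion rel by metis
  then show ?thesis using that[of s a c] st by simp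
qed

text \<open>A change of basis for \<open>u\<close> and \<open>v\<close> turns the relation into one
  between \<open>t\<close> and \<open>w\<close> only, so these two are powers of a single
  \<open>r\<close>, and \<open>s\<close>, \<open>r\<close> generate. If \<open>i\<close> and
  \<open>j\<close> both vanish, there is no such basis, but then the relation already kills
  \<open>w\<close>.\<close>

lemma (in comm_group) relation_3_imp_two_generators:
  fixes m i j k :: int
  assumes uvw: "u \<in> carrier G" "v \<in> carrier G" "w \<in> carrier G"
    and torsion: "\<forall>g \<in> carrier G. \<forall>k::int. g [^] k = \<one> \<longrightarrow> m dvd k \<or> g = \<one>"
    and rel: "u [^] i \<otimes> (v [^] j \<otimes> w [^] k) = \<one>"
    and nontrivial: "\<not> (m dvd i \<and> m dvd j \<and> m dvd k)"
    and gen: "\<forall>g \<in> carrier G. \<exists>(i::int) (j::int) (k::int). g = u [^] i \<otimes> (v [^] j \<otimes> w [^] k)"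
  obtains s r where "s \<in> carrier G" "r \<in> carrier G"
    "\<forall>g \<in> carrier G. \<exists>(i::int) (j::int). g = s [^] i \<otimes> r [^] j"
proof (cases "(i, j) = (0, 0)")
  case True
  then have "w [^] k = \<one>" "\<not> m dvd k" using rel nontrivial uvw by simp_all
  then have "w = \<one>" using torsion uvw by blast
  then show ?thesis using gen that[OF uvw(1,2)] uvw by simp
next
  case False
  then obtain s t and a b c d :: int where st: "s \<in> carrier G" "t \<in> carrier G"
    "u = s [^] a \<otimes> t [^] b" "v = s [^] c \<otimes> t [^] d" "t [^] gcd i j = u [^] i \<otimes> v [^] j"
    using unimodular_change_of_generators uvw by metis
  have "t [^] gcd i j \<otimes> w [^] k = \<one>" using rel st(5) uvw by (simp add: m_assoc)
  moreover have "\<not> (m dvd gcd i j \<and> m dvd k)" using nontrivial by simp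
  ultimately obtain r and e f :: int where r: "r \<in> carrier G" "t = r [^] e" "w = r [^] f"
    using relation_2_imp_cyclic[OF \<open>t \<in> carrier G\<close> \<open>w \<in> carrier G\<close> torsion] by blast
  have "\<exists>(i::int) (j::int). g = s [^] i \<otimes> r [^] j" if "g \<in> carrier G" for g
  proof -
    obtain x y z :: int where "g = u [^] x \<otimes> (v [^] y \<otimes> w [^] z)" using gen \<open>g \<in> carrier G\<close> by blast
    \<comment> \<open>The trivial power of \<open>s\<close> gives \<open>w\<close> the same shape as
      \<open>u\<close> and \<open>v\<close>, so that \<open>int_pow_combine\<close> applies; it is
      the source of \<open>0 * z\<close> below.\<close>
    also have "w = s [^] (0::int) \<otimes> r [^] f" using r st by simp
    finally have "g = s [^] (a * x + (c * y + 0 * z)) \<otimes> r [^] (e * b * x + (e * d * y + f * z))"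
      using r(1) st(1) by (simp only: st(3,4) r(2) int_pow_combine int_pow_pow)
    then show ?thesis by blast
  qed
  then show ?thesis using that r st by blast
qed

section \<open>Classification by descent on the number of generators\<close>

lemma (in comm_group) classify_1:
  assumes u: "u \<in> carrier G"
    and exponent: "\<forall>g \<in> carrier G. g [^] int m = \<one>"
    and torsion: "\<forall>g \<in> carrier G. \<forall>k::int. g [^] k = \<one> \<longrightarrow> int m dvd k \<or> g = \<one>"
    and gen: "\<forall>g \<in> carrier G. \<exists>i::int. g = u [^] i"
  shows "G \<cong> integer_mod_group m \<or> carrier G = {\<one>}"
proof (cases "\<exists>i::int. u [^] i = \<one> \<and> \<not> int m dvd i")
  case True
  then have "u = \<one>" using torsion u by blast
  then show ?thesis using gen by auto
next
  case False
  then show ?thesis using iso_integer_mod_group_1[of u m] assms by blast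
qed

lemma (in comm_group) classify_2:
  assumes uv: "u \<in> carrier G" "v \<in> carrier G"
    and exponent: "\<forall>g \<in> carrier G. g [^] int m = \<one>"
    and torsion: "\<forall>g \<in> carrier G. \<forall>k::int. g [^] k = \<one> \<longrightarrow> int m dvd k \<or> g = \<one>"
    and gen: "\<forall>g \<in> carrier G. \<exists>(i::int) (j::int). g = u [^] i \<otimes> v [^] j"
  shows "G \<cong> integer_mod_group m \<times>\<times> integer_mod_group m
    \<or> G \<cong> integer_mod_group m \<or> carrier G = {\<one>}"
proof (cases "\<exists>(i::int) (j::int). u [^] i \<otimes> v [^] j = \<one> \<and> \<not> (int m dvd i \<and> int m dvd j)")
  case True
  then obtain w and a b :: int where w: "w \<in> carrier G" "u = w [^] a" "v = w [^] b"
    using relation_2_imp_cyclic[OF uv torsion] by blast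
  have "\<exists>i::int. g = w [^] i" if "g \<in> carrier G" for g
  proof -
    obtain i j :: int where "g = u [^] i \<otimes> v [^] j" using gen \<open>g \<in> carrier G\<close> by blast
    then have "g = w [^] (a * i + b * j)" using w by (simp add: int_pow_mult int_pow_pow)
    then show ?thesis by blast
  qed
  then show ?thesis using classify_1[OF w(1) exponent torsion] by metis
next
  case False
  then show ?thesis using iso_integer_mod_group_2[of u v m] assms by blast
qed

text \<open>The first alternative also records the independence of the given generators. A concrete
  relation between them then excludes it directly, without comparing ranks of free abelian
  groups.\<close>

lemma (in comm_group) classify_3:
  assumes uvw: "u \<in> carrier G" "v \<in> carrier G" "w \<in> carrier G"
    and exponent: "\<forall>g \<in> carrier G. g [^] int m = \<one>"
    and torsion: "\<forall>g \<in> carrier G. \<forall>k::int. g [^] k = \<one> \<longrightarrow> int m dvd k \<or> g = \<one>"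
    and gen: "\<forall>g \<in> carrier G. \<exists>(i::int) (j::int) (k::int). g = u [^] i \<otimes> (v [^] j \<otimes> w [^] k)"
  shows "(G \<cong> integer_mod_group m \<times>\<times> integer_mod_group m \<times>\<times> integer_mod_group m
      \<and> (\<forall>(i::int) (j::int) (k::int). u [^] i \<otimes> (v [^] j \<otimes> w [^] k) = \<one>
          \<longrightarrow> int m dvd i \<and> int m dvd j \<and> int m dvd k))
    \<or> G \<cong> integer_mod_group m \<times>\<times> integer_mod_group m
    \<or> G \<cong> integer_mod_group m \<or> carrier G = {\<one>}"
proof (cases "\<exists>(i::int) (j::int) (k::int). u [^] i \<otimes> (v [^] j \<otimes> w [^] k) = \<one>
    \<and> \<not> (int m dvd i \<and> int m dvd j \<and> int m dvd k)")
  case True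
  then obtain s r where "s \<in> carrier G" "r \<in> carrier G"
    "\<forall>g \<in> carrier G. \<exists>(i::int) (j::int). g = s [^] i \<otimes> r [^] j"
    using relation_3_imp_two_generators[OF uvw torsion _ _ gen] by blast
  then show ?thesis using classify_2[OF _ _ exponent torsion] by blast
next
  case False
  then show ?thesis using iso_integer_mod_group_3[of u v w m] assms by blast
qed

section \<open>Commutative self-similar groups\<close>

lemma (in comm_monoid) mult_square:
  assumes "a \<in> carrier G" "b \<in> carrier G"
  shows "a \<otimes> (b \<otimes> b) \<otimes> a = (a \<otimes> b) \<otimes> (a \<otimes> b)"
  using assms by (simp add: m_ac)

text \<open>
  For an element \<open>g\<close> of a self-similar group over the binary alphabet, \<open>P g\<close> says whether \<open>g\<close> swaps
  the letters and \<open>sec x g\<close> is the action of \<open>g\<close> below the letter \<open>x\<close>.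
\<close>

locale self_similar_comm_group = comm_group G for G (structure) +
  fixes P :: "'a \<Rightarrow> bool" and sec :: "bool \<Rightarrow> 'a \<Rightarrow> 'a"
  assumes sec_closed [simp]: "g \<in> carrier G \<Longrightarrow> sec x g \<in> carrier G"
    and P_mult [simp]: "g \<in> carrier G \<Longrightarrow> h \<in> carrier G \<Longrightarrow> P (g \<otimes> h) \<longleftrightarrow> P g \<noteq> P h"
    and sec_mult: "g \<in> carrier G \<Longrightarrow> h \<in> carrier G
      \<Longrightarrow> sec x (g \<otimes> h) = sec (x \<noteq> P h) g \<otimes> sec x h"
    and trivial_if_section_closed: "S \<subseteq> carrier G
      \<Longrightarrow> (\<And>g. g \<in> S \<Longrightarrow> \<not> P g) \<Longrightarrow> (\<And>g x. g \<in> S \<Longrightarrow> sec x g \<in> S) \<Longrightarrow> g \<in> S \<Longrightarrow> g = \<one>"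
begin

lemma P_one [simp]: "\<not> P \<one>"
  using P_mult[of \<one> \<one>] by simp

lemma sec_one [simp]: "sec x \<one> = \<one>"
  using sec_mult[of \<one> \<one> x] by (simp add: l_cancel_one')

lemma sec_commute:
  assumes "g \<in> carrier G" "h \<in> carrier G"
  shows "sec (x \<noteq> P h) g \<otimes> sec x h = sec (x \<noteq> P g) h \<otimes> sec x g"
  using assms sec_mult m_comm by metis

text \<open>Comparing the sections of \<open>s \<otimes> h\<close> and \<open>h \<otimes> s\<close>
  for an active \<open>s\<close> gives the claim, because \<open>s\<close> moves one letter to the
  other. If nothing is active, the whole carrier is closed under sections, so the group is
  trivial.\<close>

lemma sec_inactive:
  assumes h: "h \<in> carrier G" "\<not> P h"
  shows "sec x h = sec y h"
proof (cases "\<exists>s \<in> carrier G. P s")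
  case True
  then obtain s where s: "s \<in> carrier G" "P s" by blast
  have "sec True h = sec False h"
    using sec_commute[of s h True] s h by (simp add: m_comm[of "sec True s"])
  then show ?thesis by (cases x; cases y) simp_all
next
  case False
  then have "h = \<one>" using h(1) by (intro trivial_if_section_closed[of "carrier G"]) auto
  then show ?thesis by simp
qed

text \<open>An active \<open>g\<close> passes through both of its sections, in an order that depends
  on \<open>x\<close> and is irrelevant here; for an inactive \<open>g\<close> the two sections
  coincide.\<close>

lemma sec_square:
  assumes "g \<in> carrier G"
  shows "sec x (g \<otimes> g) = sec False g \<otimes> sec True g"
proof (cases "P g")
  case True
  then show ?thesis using assms by (cases x) (simp_all add: sec_mult m_comm)
next
  case False
  then show ?thesis using assms sec_inactive[of g] by (simp add: sec_mult) metis
qed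

text \<open>Equating the sections of \<open>t \<otimes> s\<close> and \<open>s \<otimes> t\<close>
  at \<open>False\<close> relates the sections of the two elements crosswise, so the quotient is an
  invariant of the group.\<close>

lemma sec_active_difference:
  assumes "s \<in> carrier G" "P s" "t \<in> carrier G" "P t"
  shows "sec False t = sec True t \<otimes> (sec False s \<otimes> inv (sec True s))"
proof -
  have "sec True t \<otimes> sec False s = sec True s \<otimes> sec False t"
    using sec_commute[of t s False] assms by simp
  then have "sec True t \<otimes> sec False s \<otimes> inv (sec True s) = sec False t"
    using assms by (simp add: m_comm[of "sec True s"] m_assoc)
  then show ?thesis using assms by (simp add: m_assoc)
qed

lemma P_nat_pow: "g \<in> carrier G \<Longrightarrow> P (g [^] (k::nat)) \<longleftrightarrow> P g \<and> odd k"
  by (induction k) auto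

lemma sec_nat_pow:
  "g \<in> carrier G \<Longrightarrow> \<not> P g \<Longrightarrow> sec x (g [^] (k::nat)) = sec x g [^] k"
  by (induction k) (auto simp: sec_mult)

lemma P_inv: "g \<in> carrier G \<Longrightarrow> P (inv g) \<longleftrightarrow> P g"
  using P_mult[of g "inv g"] by simp

lemma P_int_pow: "g \<in> carrier G \<Longrightarrow> P (g [^] (k::int)) \<longleftrightarrow> P g \<and> odd k"
  by (cases k) (auto simp: int_pow_int int_pow_neg_int P_nat_pow P_inv simp del: of_nat_Suc nat_pow_Suc)

lemma sec_inv: "g \<in> carrier G \<Longrightarrow> \<not> P g \<Longrightarrow> sec x (inv g) = inv (sec x g)"
  using sec_mult[of "inv g" g x] by (simp add: inv_equality)

lemma sec_int_pow:
  "g \<in> carrier G \<Longrightarrow> \<not> P g \<Longrightarrow> sec x (g [^] (k::int)) = sec x g [^] k"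
proof (cases k)
  case (neg n)
  assume g: "g \<in> carrier G" "\<not> P g"
  show ?thesis
    unfolding neg using g
    by (simp only: int_pow_neg_int sec_nat_pow sec_inv P_nat_pow nat_pow_closed sec_closed simp_thms)
qed (simp add: int_pow_int sec_nat_pow)

text \<open>For an active \<open>g\<close> sections do not commute with powers, but an even power of
  \<open>g\<close> is a power of the inactive element \<open>g \<otimes> g\<close>.\<close>

lemma sec_int_pow_double:
  assumes "g \<in> carrier G"
  shows "sec x (g [^] (2 * k :: int)) = (sec False g \<otimes> sec True g) [^] k"
proof -
  have "g [^] (2 * k) = (g \<otimes> g) [^] k"
    using assms int_pow_mult[of g k k] by (simp only: int_pow_distrib mult_2)
  then show ?thesis using assms by (simp add: sec_int_pow sec_square)
qed

text \<open>
  All active elements have the same difference of their two sections. If it is trivial, the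
  squares are closed under sections. If not, it is not a square, because otherwise again the
  squares would be closed under sections; then an involution cannot be active.
\<close>

lemma exponent_2_or_torsion_free:
  obtains "\<And>g. g \<in> carrier G \<Longrightarrow> g \<otimes> g = \<one>"
  | "\<And>g k. g \<in> carrier G \<Longrightarrow> g [^] (k::int) = \<one> \<Longrightarrow> k \<noteq> 0 \<Longrightarrow> g = \<one>"
proof -
  have squares: "g \<otimes> g = \<one>" if g: "g \<in> carrier G" and closed:
    "\<And>g. g \<in> carrier G \<Longrightarrow> \<exists>h \<in> carrier G. sec False g \<otimes> sec True g = h \<otimes> h" for g
  proof (rule trivial_if_section_closed[of "{h \<otimes> h | h. h \<in> carrier G}"])
    fix g x assume "g \<in> {h \<otimes> h | h. h \<in> carrier G}"
    then show "sec x g \<in> {h \<otimes> h | h. h \<in> carrier G}"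
      using closed by (auto simp: sec_square) blast
  qed (use g in auto)
  show ?thesis
  proof (cases "\<forall>g \<in> carrier G. sec False g = sec True g")
    case True
    then show ?thesis using squares that(1) sec_closed by metis
  next
    case False
    then obtain s where s: "s \<in> carrier G" "sec False s \<noteq> sec True s" by blast
    then have "P s" using sec_inactive by blast
    define \<delta> where "\<delta> = sec False s \<otimes> inv (sec True s)"
    have "\<delta> \<in> carrier G" using s(1) by (simp add: \<delta>_def)
    moreover from this have "sec False s = \<delta> \<otimes> sec True s"
      unfolding \<delta>_def using s(1) by (simp only: m_assoc sec_closed inv_closed l_inv r_one)
    ultimately have \<delta>: "\<delta> \<in> carrier G" "\<delta> \<noteq> \<one>" using s by auto
    have active: "sec False t = sec True t \<otimes> \<delta>" if "t \<in> carrier G" "P t" for t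
      unfolding \<delta>_def using sec_active_difference s \<open>P s\<close> that by blast
    have not_square: "\<delta> \<noteq> h \<otimes> h" if h: "h \<in> carrier G" for h
    proof
      assume eq: "\<delta> = h \<otimes> h"
      have "\<exists>k \<in> carrier G. sec False g \<otimes> sec True g = k \<otimes> k" if g: "g \<in> carrier G" for g
      proof (cases "P g")
        case True
        have "sec False g \<otimes> sec True g = sec True g \<otimes> (h \<otimes> h) \<otimes> sec True g"
          using active[OF g True] eq by simp
        also have "\<dots> = (sec True g \<otimes> h) \<otimes> (sec True g \<otimes> h)"
          using mult_square[OF _ h] sec_closed[OF g] by blast
        finally show ?thesis using g h by (meson m_closed sec_closed)
      next
        case False
        then show ?thesis using sec_inactive g sec_closed by metis
      qed
      \<comment> \<open>All squares are now trivial, and \<open>\<delta>\<close> is supposed to be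
        one of them.\<close>
      then show False using squares[OF h] eq \<delta> by simp
    qed
    have involution: "g = \<one>" if "g \<in> carrier G" "g \<otimes> g = \<one>" for g
    proof (rule trivial_if_section_closed[of "{h \<in> carrier G. h \<otimes> h = \<one>}"])
      fix g assume "g \<in> {h \<in> carrier G. h \<otimes> h = \<one>}"
      then have g: "g \<in> carrier G" "sec False g \<otimes> sec True g = \<one>"
        using sec_square[of g] by auto
      show "\<not> P g"
      proof
        assume "P g"
        then have "\<delta> \<otimes> (sec True g \<otimes> sec True g) = \<one>"
          using active g \<delta> by (simp add: m_ac)
        then have "\<delta> = inv (sec True g \<otimes> sec True g)"
          using \<delta> g by (simp add: inv_equality)
        then have "\<delta> = inv (sec True g) \<otimes> inv (sec True g)"
          using g by (simp add: inv_mult)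
        then show False using not_square[of "inv (sec True g)"] g(1) by simp
      qed
      then show "sec x g \<in> {h \<in> carrier G. h \<otimes> h = \<one>}" for x
        using g sec_inactive[of g] by (metis (mono_tags, lifting) mem_Collect_eq sec_closed)
    qed (use that in auto)
    \<comment> \<open>An even exponent can be halved, since there are no nontrivial involutions. An
      odd exponent forces \<open>g\<close> to be inactive, and powers of inactive elements commute
      with sections, so the \<open>k\<close>-torsion is closed under sections.\<close>
    have nat: "g = \<one>" if "g \<in> carrier G" "g [^] k = \<one>" "k > 0" for g and k :: nat
      using that
    proof (induction k rule: less_induct)
      case (less k)
      show ?case
      proof (cases "even k")
        case True
        then obtain l where "k = l + l" by (metis evenE mult_2)
        then have "g [^] l \<otimes> g [^] l = \<one>" using less.prems by (simp add: nat_pow_mult)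
        then have "g [^] l = \<one>" using involution[of "g [^] l"] less.prems(1) by simp
        then show ?thesis using less.IH[of l] less.prems(1,3) \<open>k = l + l\<close> by simp
      next
        case False
        show ?thesis
        proof (rule trivial_if_section_closed[of "{h \<in> carrier G. h [^] k = \<one>}"])
          fix g assume g: "g \<in> {h \<in> carrier G. h [^] k = \<one>}"
          show "\<not> P g" using P_nat_pow[of g k] g False by auto
          then show "sec x g \<in> {h \<in> carrier G. h [^] k = \<one>}" for x
            using sec_nat_pow[of g x k] g by auto
        qed (use less.prems in auto)
      qed
    qed
    have "g = \<one>" if g: "g \<in> carrier G" "g [^] k = \<one>" "k \<noteq> 0" for g and k :: int
    proof (cases k)
      case (nonneg n)
      then show ?thesis using nat[of g n] g by (simp add: int_pow_int)
    next
      case (neg n)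
      then have "inv (g [^] Suc n) = \<one>" using g by (simp only: int_pow_neg_int)
      then have "g [^] Suc n = \<one>" using g by (metis inv_eq_1_iff nat_pow_closed)
      then show ?thesis using nat g by blast
    qed
    then show ?thesis using that(2) by blast
  qed
qed

end

section \<open>A relation between the states from a stationary measure\<close>

lemma two_linear_equations_three_unknowns:
  fixes a b c a' b' c' :: int
  obtains x y z :: int where "(x, y, z) \<noteq> (0, 0, 0)"
    "a * x + b * y + c * z = 0" "a' * x + b' * y + c' * z = 0"
proof (cases "b * c' = b' * c \<and> c * a' = c' * a \<and> a * b' = a' * b")
  case False
  \<comment> \<open>The cross product of the coefficient vectors is orthogonal to both of
    them.\<close>
  then show ?thesis
    by (intro that[of "b * c' - b' * c" "c * a' - c' * a" "a * b' - a' * b"])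
      (auto simp: algebra_simps)
next
  \<comment> \<open>The coefficient vectors are proportional, so a vector orthogonal to a nonzero
    one of them serves both equations.\<close>
  case True
  consider "(a, b) \<noteq> (0, 0)" | "(b, c) \<noteq> (0, 0)" | "(a', b') \<noteq> (0, 0)" | "(b', c') \<noteq> (0, 0)"
    | "a = 0" "b = 0" "c = 0" "a' = 0" "b' = 0" "c' = 0" by force
  then show ?thesis
  proof cases
    case 1 with True show ?thesis by (intro that[of b "- a" 0]) (auto simp: mult.commute)
  next
    case 2 with True show ?thesis by (intro that[of 0 c "- b"]) (auto simp: mult.commute)
  next
    case 3 with True show ?thesis by (intro that[of b' "- a'" 0]) (auto simp: mult.commute)
  next
    case 4 with True show ?thesis by (intro that[of 0 c' "- b'"]) (auto simp: mult.commute)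
  next
    case 5 then show ?thesis by (intro that[of 1 0 0]) auto
  qed
qed

text \<open>
  A stationary measure of the random walk on the states that moves with probability 1/2 to each
  of the two successors.
\<close>

lemma stationary_measure_exists:
  fixes n0 n1 :: "state \<Rightarrow> state"
  shows "\<exists>v :: state \<Rightarrow> int. (\<exists>s. v s \<noteq> 0) \<and> (\<forall>t.
    (\<Sum>s \<in> {S1, S2, S3}. v s * (of_bool (n0 s = t) + of_bool (n1 s = t))) = 2 * v t)"
proof -
  define C :: "state \<Rightarrow> state \<Rightarrow> int" where "C s t = of_bool (n0 s = t) + of_bool (n1 s = t)" for s t
  have row: "C s S1 + C s S2 + C s S3 = 2" for s
    by (cases "n0 s"; cases "n1 s") (simp_all add: C_def)
  \<comment> \<open>Two equations suffice: since each row of \<open>C\<close> sums to 2, the three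
    stationarity equations add up to a tautology, and the one for \<open>S3\<close> follows from the
    others.\<close>
  obtain x y z where xyz: "(x, y, z) \<noteq> (0, 0, 0)"
    "(C S1 S1 - 2) * x + C S2 S1 * y + C S3 S1 * z = 0"
    "C S1 S2 * x + (C S2 S2 - 2) * y + C S3 S2 * z = 0"
    by (rule two_linear_equations_three_unknowns)
  define v where "v = case_state x y z"
  have C3: "C S1 S3 = 2 - C S1 S1 - C S1 S2" "C S2 S3 = 2 - C S2 S1 - C S2 S2"
    "C S3 S3 = 2 - C S3 S1 - C S3 S2"
    using row[of S1] row[of S2] row[of S3] by linarith+
  have "v S1 * C S1 t + v S2 * C S2 t + v S3 * C S3 t = 2 * v t" for t
    using xyz(2,3) by (cases t) (simp_all add: v_def C3 algebra_simps)
  moreover have "\<exists>s. v s \<noteq> 0"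
    using xyz(1) by (auto simp: v_def intro: exI[of _ S1] exI[of _ S2] exI[of _ S3])
  ultimately show ?thesis by (intro exI[of _ v]) (simp add: C_def add.assoc)
qed

context self_similar_comm_group
begin

text \<open>By \<open>sec_square\<close> this is the common section of the square of
  \<open>g\<close>. Unlike a single section, it is multiplicative on active elements too.\<close>

definition section_product :: "'a \<Rightarrow> 'a" where
  "section_product g = sec False g \<otimes> sec True g"

text \<open>Squaring is a homomorphism into the inactive elements, and on those taking a section is
  a homomorphism.\<close>

lemma section_product_hom: "section_product \<in> hom G G"
proof (rule homI)
  show "section_product g \<in> carrier G" if "g \<in> carrier G" for g
    using that by (simp add: section_product_def)
  show "section_product (g \<otimes> h) = section_product g \<otimes> section_product h"
    if gh: "g \<in> carrier G" "h \<in> carrier G" for g h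
  proof -
    have "section_product (g \<otimes> h) = sec False ((g \<otimes> g) \<otimes> (h \<otimes> h))"
      using gh by (simp add: section_product_def sec_square[of "g \<otimes> h" False, symmetric] m_ac)
    also have "\<dots> = sec False (g \<otimes> g) \<otimes> sec False (h \<otimes> h)"
      using gh by (subst sec_mult) auto
    finally show ?thesis using gh by (simp add: section_product_def sec_square)
  qed
qed

text \<open>On exponent vectors \<open>section_product\<close> is the transition count matrix. A
  vector \<open>v\<close> with eigenvalue 2 therefore gives an element \<open>L v\<close> whose
  \<open>section_product\<close> is its own square. The map \<open>L\<close> need not be injective;
  what matters is that \<open>v\<close> is nonzero.\<close>

lemma relation_between_states:
  assumes q: "\<And>s. q s \<in> carrier G"
    and sec_q: "\<And>s. sec False (q s) = q (n0 s)" "\<And>s. sec True (q s) = q (n1 s)"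
    and torsion_free: "\<And>g. g \<in> carrier G \<Longrightarrow> g \<otimes> g = \<one> \<Longrightarrow> g = \<one>"
  obtains i j k :: int where "(i, j, k) \<noteq> (0, 0, 0)"
    "q S1 [^] i \<otimes> (q S2 [^] j \<otimes> q S3 [^] k) = \<one>"
proof -
  define L :: "(state \<Rightarrow> int) \<Rightarrow> 'a" where
    "L v = q S1 [^] v S1 \<otimes> (q S2 [^] v S2 \<otimes> q S3 [^] v S3)" for v
  have L_closed: "L v \<in> carrier G" for v by (simp add: L_def q)
  have L_mult: "L v \<otimes> L w = L (\<lambda>t. v t + w t)" for v w
    using q by (simp add: L_def int_pow_mult m_ac)
  have L_pow: "L v [^] k = L (\<lambda>t. k * v t)" for v and k :: int
    using q by (simp add: L_def int_pow_distrib int_pow_pow mult.commute)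
  have q_eq: "q t = L (\<lambda>s. of_bool (t = s))" for t
    using q by (cases t) (simp_all add: L_def)
  obtain v :: "state \<Rightarrow> int" where v: "\<exists>s. v s \<noteq> 0"
    "\<And>t. (\<Sum>s \<in> {S1, S2, S3}. v s * (of_bool (n0 s = t) + of_bool (n1 s = t))) = 2 * v t"
    using stationary_measure_exists[of n0 n1] by blast
  interpret N: group_hom G G section_product
    by (simp add: group_hom_def group_hom_axioms_def is_group section_product_hom)
  have sp_q: "section_product (q s) = L (\<lambda>t. of_bool (n0 s = t) + of_bool (n1 s = t))" for s
    unfolding section_product_def sec_q by (simp add: q_eq L_mult)
  have "section_product (L v) = section_product (q S1) [^] v S1
      \<otimes> (section_product (q S2) [^] v S2 \<otimes> section_product (q S3) [^] v S3)"
    using q by (simp add: L_def N.hom_int_pow)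
  also have "\<dots> = L (\<lambda>t. \<Sum>s \<in> {S1, S2, S3}. v s * (of_bool (n0 s = t) + of_bool (n1 s = t)))"
    by (simp add: sp_q L_pow L_mult)
  also have "\<dots> = L v \<otimes> L v" by (simp only: v L_mult mult_2)
  finally have "sec x (L v \<otimes> L v) = L v \<otimes> L v" for x
    by (simp add: sec_square L_closed section_product_def)
  \<comment> \<open>The square is inactive and equal to both of its sections, so the singleton is
    closed under sections.\<close>
  then have "L v \<otimes> L v = \<one>"
    by (intro trivial_if_section_closed[of "{L v \<otimes> L v}"]) (auto simp: L_closed)
  then have "L v = \<one>" using torsion_free L_closed by blast
  moreover have "(v S1, v S2, v S3) \<noteq> (0, 0, 0)" using v(1) by (metis prod.inject state.exhaust)
  ultimately show ?thesis using that by (simp add: L_def)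
qed

text \<open>The two branches instantiate \<open>classify_3\<close> with \<open>m = 2\<close> and
  \<open>m = 0\<close>; for \<open>m = 0\<close> the relation between the states removes the rank 3
  alternative.\<close>

theorem classification:
  assumes q: "\<And>s. q s \<in> carrier G"
    and sec_q: "\<And>s. sec False (q s) = q (n0 s)" "\<And>s. sec True (q s) = q (n1 s)"
    and gen: "\<forall>g \<in> carrier G. \<exists>(i::int) (j::int) (k::int).
      g = q S1 [^] i \<otimes> (q S2 [^] j \<otimes> q S3 [^] k)"
  shows "G \<cong> integer_mod_group 2 \<times>\<times> integer_mod_group 2 \<times>\<times> integer_mod_group 2
    \<or> G \<cong> integer_mod_group 2 \<times>\<times> integer_mod_group 2 \<or> G \<cong> integer_mod_group 2
    \<or> G \<cong> integer_group \<times>\<times> integer_group \<or> G \<cong> integer_group \<or> carrier G = {\<one>}"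
proof (rule exponent_2_or_torsion_free)
  assume square: "\<And>g. g \<in> carrier G \<Longrightarrow> g \<otimes> g = \<one>"
  have two: "g [^] (2::int) = \<one>" if "g \<in> carrier G" for g
    using int_pow_mult[OF that, of 1 1] square that by simp
  have "g = \<one>" if "g \<in> carrier G" "g [^] k = \<one>" "\<not> 2 dvd k" for g and k :: int
    using int_pow_mod_exponent[OF that(1) two, of k] that by (simp add: odd_iff_mod_2_eq_one)
  then have "\<forall>g \<in> carrier G. \<forall>k::int. g [^] k = \<one> \<longrightarrow> int 2 dvd k \<or> g = \<one>" by auto
  moreover have "\<forall>g \<in> carrier G. g [^] int 2 = \<one>" using two by simp
  ultimately show ?thesis using classify_3[OF q q q _ _ gen, of 2] by blast
next
  assume tf: "\<And>g k. g \<in> carrier G \<Longrightarrow> g [^] (k::int) = \<one> \<Longrightarrow> k \<noteq> 0 \<Longrightarrow> g = \<one>"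
  have "g = \<one>" if "g \<in> carrier G" "g \<otimes> g = \<one>" for g
    using tf[of g 2] int_pow_mult[OF that(1), of 1 1] that by simp
  then obtain i j k :: int where "(i, j, k) \<noteq> (0, 0, 0)"
    "q S1 [^] i \<otimes> (q S2 [^] j \<otimes> q S3 [^] k) = \<one>"
    using relation_between_states[OF q sec_q] by metis
  moreover have "\<forall>g \<in> carrier G. \<forall>k::int. g [^] k = \<one> \<longrightarrow> int 0 dvd k \<or> g = \<one>"
    using tf by auto
  moreover have "\<forall>g \<in> carrier G. g [^] int 0 = \<one>" by simp
  ultimately have "G \<cong> integer_mod_group 0 \<times>\<times> integer_mod_group 0
    \<or> G \<cong> integer_mod_group 0 \<or> carrier G = {\<one>}"
    using classify_3[OF q q q _ _ gen, of 0] by auto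
  then show ?thesis by (auto simp: integer_mod_group_def)
qed

end

section \<open>Automaton groups\<close>

lemma (in group) commute_generated:
  assumes "S \<subseteq> carrier G" "x \<in> carrier G" "\<And>s. s \<in> S \<Longrightarrow> x \<otimes> s = s \<otimes> x"
    and "g \<in> generate G S"
  shows "x \<otimes> g = g \<otimes> x"
  using assms(4)
proof induction
  case one
  then show ?case using assms by simp
next
  case (incl h)
  then show ?case using assms by blast
next
  case (inv h)
  then have h: "h \<in> carrier G" "x \<otimes> h = h \<otimes> x" using assms by auto
  \<comment> \<open>Multiplying \<open>x \<otimes> h = h \<otimes> x\<close> by \<open>inv h\<close>
    from both sides carries the commutation over to the inverse.\<close>
  have "inv h \<otimes> (h \<otimes> x) \<otimes> inv h = x \<otimes> inv h"
    using h(1) assms(2) by (simp flip: m_assoc)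
  moreover have "inv h \<otimes> (x \<otimes> h) \<otimes> inv h = inv h \<otimes> x"
    using h(1) assms(2) by (simp add: m_assoc)
  ultimately show ?case by (simp only: h(2))
next
  case (eng g h)
  then have gh: "g \<in> carrier G" "h \<in> carrier G"
    using generate_in_carrier[OF assms(1)] by blast+
  have "x \<otimes> (g \<otimes> h) = (x \<otimes> g) \<otimes> h" using gh assms(2) by (simp add: m_assoc)
  also have "\<dots> = g \<otimes> (x \<otimes> h)" using gh assms(2) eng by (simp add: m_assoc)
  also have "\<dots> = (g \<otimes> h) \<otimes> x" using gh assms(2) eng by (simp add: m_assoc)
  finally show ?case .
qed

lemma group_automaton_group: "group (automaton_group A)"
  by (simp add: automaton_group_def group.group_subgroup_generated group_tree_Aut)

lemma carrier_automaton_group: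
  "carrier (automaton_group A) = generate tree_Aut (range (act A))"
proof -
  have "carrier tree_Aut \<inter> range (act A) = range (act A)" using act_in_tree_Aut by auto
  then show ?thesis by (simp add: automaton_group_def carrier_subgroup_generated)
qed

lemma carrier_automaton_group_subset: "carrier (automaton_group A) \<subseteq> carrier tree_Aut"
  by (simp add: automaton_group_def group.carrier_subgroup_generated_subset group_tree_Aut)

lemma act_in_automaton_group [simp]: "act A q \<in> carrier (automaton_group A)"
  by (simp add: carrier_automaton_group generate.incl)

lemma mult_tree_Aut:
  "f \<in> carrier tree_Aut \<Longrightarrow> g \<in> carrier tree_Aut \<Longrightarrow> f \<otimes>\<^bsub>tree_Aut\<^esub> g = f \<circ> g"
  by (simp add: tree_Aut_def BijGroup_def Bij_def compose_def fun_eq_iff)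

lemma one_tree_Aut: "\<one>\<^bsub>tree_Aut\<^esub> = id"
  by (simp add: tree_Aut_def BijGroup_def fun_eq_iff)

lemma mult_automaton_group:
  assumes "f \<in> carrier (automaton_group A)" "g \<in> carrier (automaton_group A)"
  shows "f \<otimes>\<^bsub>automaton_group A\<^esub> g = f \<circ> g"
  using assms carrier_automaton_group_subset mult_tree_Aut by (fastforce simp: automaton_group_def)

lemma one_automaton_group: "\<one>\<^bsub>automaton_group A\<^esub> = id"
  by (simp add: automaton_group_def one_tree_Aut)

lemma act_int_pow_2:
  assumes "\<And>w. act A q (act A q w) = w"
  shows "act A q [^]\<^bsub>automaton_group A\<^esub> (2::int) = \<one>\<^bsub>automaton_group A\<^esub>"
proof -
  interpret group "automaton_group A" by (rule group_automaton_group)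
  have "act A q [^]\<^bsub>automaton_group A\<^esub> (2::int) = act A q \<otimes>\<^bsub>automaton_group A\<^esub> act A q"
    using int_pow_mult[of "act A q" 1 1] by simp
  then show ?thesis using assms by (simp add: mult_automaton_group one_automaton_group fun_eq_iff)
qed

text \<open>This reduces commutativity to an identity between words that induction can check.
  Passing from generators to the group takes two rounds: each state commutes with \<open>f\<close>,
  and hence \<open>f\<close> commutes with \<open>g\<close>.\<close>

lemma comm_group_automaton_group:
  assumes "\<And>p q w. act A p (act A q w) = act A q (act A p w)"
  shows "comm_group (automaton_group A)"
proof (rule group.group_comm_groupI[OF group_automaton_group])
  interpret T: group tree_Aut by (rule group_tree_Aut)
  have sub: "range (act A) \<subseteq> carrier tree_Aut" using act_in_tree_Aut by auto
  have gens: "act A p \<otimes>\<^bsub>tree_Aut\<^esub> act A q = act A q \<otimes>\<^bsub>tree_Aut\<^esub> act A p" for p q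
    using assms by (auto simp: mult_tree_Aut act_in_tree_Aut)
  fix f g assume "f \<in> carrier (automaton_group A)" "g \<in> carrier (automaton_group A)"
  then have f: "f \<in> generate tree_Aut (range (act A))" and g: "g \<in> generate tree_Aut (range (act A))"
    by (simp_all add: carrier_automaton_group)
  have "act A q \<otimes>\<^bsub>tree_Aut\<^esub> f = f \<otimes>\<^bsub>tree_Aut\<^esub> act A q" for q
    by (rule T.commute_generated[OF sub _ _ f]) (auto simp: act_in_tree_Aut gens)
  then have "f \<otimes>\<^bsub>tree_Aut\<^esub> g = g \<otimes>\<^bsub>tree_Aut\<^esub> f"
    using T.generate_in_carrier[OF sub f] by (intro T.commute_generated[OF sub _ _ g]) auto
  then show "f \<otimes>\<^bsub>automaton_group A\<^esub> g = g \<otimes>\<^bsub>automaton_group A\<^esub> f"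
    by (simp add: automaton_group_def)
qed

text \<open>By commutativity the ordered products of powers already form a subgroup, and it contains
  the three states.\<close>

lemma automaton_group_generated_by_states:
  assumes "comm_group (automaton_group A)"
  shows "\<forall>g \<in> carrier (automaton_group A). \<exists>(i::int) (j::int) (k::int).
    g = act A S1 [^]\<^bsub>automaton_group A\<^esub> i \<otimes>\<^bsub>automaton_group A\<^esub>
      (act A S2 [^]\<^bsub>automaton_group A\<^esub> j \<otimes>\<^bsub>automaton_group A\<^esub> act A S3 [^]\<^bsub>automaton_group A\<^esub> k)"
proof -
  interpret G: comm_group "automaton_group A" by (rule assms)
  interpret T: group tree_Aut by (rule group_tree_Aut)
  define L where "L i j k = act A S1 [^]\<^bsub>automaton_group A\<^esub> i \<otimes>\<^bsub>automaton_group A\<^esub>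
      (act A S2 [^]\<^bsub>automaton_group A\<^esub> j \<otimes>\<^bsub>automaton_group A\<^esub> act A S3 [^]\<^bsub>automaton_group A\<^esub> k)"
    for i j k :: int
  have L_closed: "L i j k \<in> carrier (automaton_group A)" for i j k by (simp add: L_def)
  have L_mult: "L i j k \<otimes>\<^bsub>automaton_group A\<^esub> L i' j' k' = L (i + i') (j + j') (k + k')"
    for i j k i' j' k'
    by (simp add: L_def G.int_pow_mult G.m_ac)
  have L_inv: "inv\<^bsub>automaton_group A\<^esub> (L i j k) = L (- i) (- j) (- k)" for i j k
    by (rule G.inv_equality) (simp_all add: L_mult L_closed, simp add: L_def)
  have "subgroup {L i j k | i j k. True} (automaton_group A)"
    by (rule G.subgroupI) (use L_closed L_mult L_inv in \<open>fastforce+\<close>)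
  moreover have "act A q \<in> {L i j k | i j k. True}" for q
  proof -
    have "act A q = L (of_bool (q = S1)) (of_bool (q = S2)) (of_bool (q = S3))"
      by (cases q) (simp_all add: L_def)
    then show ?thesis by blast
  qed
  ultimately have "carrier (subgroup_generated (automaton_group A) (range (act A)))
      \<subseteq> {L i j k | i j k. True}"
    by (intro G.subgroup_generated_minimal) auto
  then show ?thesis by (auto simp: automaton_group_def L_def)
qed

section \<open>Self-similarity of automaton groups\<close>

definition root_swap :: "(letter list \<Rightarrow> letter list) \<Rightarrow> bool" where
  "root_swap f \<longleftrightarrow> hd (f [False])"

definition section_at :: "letter \<Rightarrow> (letter list \<Rightarrow> letter list) \<Rightarrow> letter list \<Rightarrow> letter list" where
  "section_at x f w = tl (f (x # w))"

text \<open>That sections stay in the group does not follow from being a tree automorphism, hence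
  the induction over the generated group. The existential form lets each case name its sections
  explicitly.\<close>

lemma automaton_group_decompose:
  assumes "f \<in> carrier (automaton_group A)"
  shows "\<exists>p s. (\<forall>x. s x \<in> carrier (automaton_group A)) \<and> (\<forall>x w. f (x # w) = (x \<noteq> p) # s x w)"
proof -
  interpret T: group tree_Aut by (rule group_tree_Aut)
  have "f \<in> generate tree_Aut (range (act A))" using assms by (simp add: carrier_automaton_group)
  then show ?thesis
  proof induction
    case one
    show ?case
      by (rule exI[of _ False], rule exI[of _ "\<lambda>_. id"])
        (use monoid.one_closed[OF group.is_monoid[OF group_automaton_group[of A]]] in
          \<open>simp add: one_tree_Aut one_automaton_group id_def\<close>)
  next
    case (incl h)
    then obtain q where h: "h = act A q" by blast
    show ?case unfolding h
      by (rule exI[of _ "swaps A q"], rule exI[of _ "\<lambda>x. act A (if x then next1 A q else next0 A q)"])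
        (auto simp: act_Cons)
  next
    case (inv h)
    then obtain q where h: "h = act A q" by blast
    let ?i = "\<lambda>q. inv\<^bsub>tree_Aut\<^esub> act A q"
    have inv_act: "act A r (?i r w) = w" "?i r (act A r w) = w" for r w
      using T.r_inv[of "act A r"] T.l_inv[of "act A r"]
      by (simp_all add: mult_tree_Aut act_in_tree_Aut one_tree_Aut fun_eq_iff)
    \<comment> \<open>The inverse first undoes the swap, so its section at \<open>x\<close> inverts
      the state that \<open>q\<close> reaches after reading the preimage of
      \<open>x\<close>.\<close>
    let ?s = "\<lambda>x. ?i (if x \<noteq> swaps A q then next1 A q else next0 A q)"
    have "?i q (x # w) = (x \<noteq> swaps A q) # ?s x w" for x w
    proof -
      have "act A q ((x \<noteq> swaps A q) # ?s x w) = x # w"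
        by (auto simp: act_Cons inv_act)
      then show ?thesis using inv_act(2)[of q] by metis
    qed
    moreover have "?s x \<in> carrier (automaton_group A)" for x
      by (simp add: carrier_automaton_group generate.inv)
    ultimately show ?case
      unfolding h by (intro exI[of _ "swaps A q"] exI[of _ ?s]) blast
  next
    case (eng g h)
    then obtain p s p' s' where
      s: "\<And>x. s x \<in> carrier (automaton_group A)" "\<And>x w. g (x # w) = (x \<noteq> p) # s x w" and
      s': "\<And>x. s' x \<in> carrier (automaton_group A)" "\<And>x w. h (x # w) = (x \<noteq> p') # s' x w"
      by blast
    have "g \<otimes>\<^bsub>tree_Aut\<^esub> h = g \<circ> h"
      using eng.hyps carrier_automaton_group_subset
      by (intro mult_tree_Aut) (auto simp: carrier_automaton_group)
    then have "(g \<otimes>\<^bsub>tree_Aut\<^esub> h) (x # w) = (x \<noteq> (p \<noteq> p')) # (s (x \<noteq> p') \<circ> s' x) w" for x w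
      by (auto simp: s s')
    moreover have "s (x \<noteq> p') \<circ> s' x \<in> carrier (automaton_group A)" for x
      using s(1) s'(1) mult_automaton_group
        monoid.m_closed[OF group.is_monoid[OF group_automaton_group]] by metis
    ultimately show ?case
      by (intro exI[of _ "p \<noteq> p'"] exI[of _ "\<lambda>x. s (x \<noteq> p') \<circ> s' x"]) blast
  qed
qed

lemma automaton_group_Nil:
  assumes "f \<in> carrier (automaton_group A)"
  shows "f [] = []"
  using assms carrier_automaton_group_subset by (auto simp: carrier_tree_Aut)

lemma automaton_group_Cons:
  assumes "f \<in> carrier (automaton_group A)"
  shows "f (x # w) = (x \<noteq> root_swap f) # section_at x f w"
proof -
  obtain p s where "\<And>x w. f (x # w) = (x \<noteq> p) # s x w"
    using automaton_group_decompose[OF assms] by blast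
  then show ?thesis by (simp add: root_swap_def section_at_def)
qed

lemma section_at_in_automaton_group:
  assumes "f \<in> carrier (automaton_group A)"
  shows "section_at x f \<in> carrier (automaton_group A)"
proof -
  obtain p s where s: "\<And>x. s x \<in> carrier (automaton_group A)" "\<And>x w. f (x # w) = (x \<noteq> p) # s x w"
    using automaton_group_decompose[OF assms] by blast
  then have "section_at x f = s x" by (simp add: section_at_def fun_eq_iff)
  then show ?thesis using s by simp
qed

lemma root_swap_act [simp]: "root_swap (act A q) = swaps A q"
  by (simp add: root_swap_def act_Cons)

lemma section_at_act [simp]: "section_at x (act A q) = act A (if x then next1 A q else next0 A q)"
  by (simp add: section_at_def act_Cons fun_eq_iff)

lemma self_similar_automaton_group:
  assumes "comm_group (automaton_group A)"
  shows "self_similar_comm_group (automaton_group A) root_swap section_at"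
proof -
  interpret G: comm_group "automaton_group A" by (rule assms)
  show ?thesis
  proof (unfold_locales)
    show "section_at x g \<in> carrier (automaton_group A)" if "g \<in> carrier (automaton_group A)" for x g
      using that by (rule section_at_in_automaton_group)
  next
    fix g h assume gh: "g \<in> carrier (automaton_group A)" "h \<in> carrier (automaton_group A)"
    have *: "(g \<otimes>\<^bsub>automaton_group A\<^esub> h) (x # w) =
      (x \<noteq> (root_swap g \<noteq> root_swap h)) # section_at (x \<noteq> root_swap h) g (section_at x h w)" for x w
      using gh by (auto simp: mult_automaton_group automaton_group_Cons)
    show "root_swap (g \<otimes>\<^bsub>automaton_group A\<^esub> h) \<longleftrightarrow> root_swap g \<noteq> root_swap h"
      using *[of False] by (simp add: root_swap_def[of "g \<otimes>\<^bsub>automaton_group A\<^esub> h"])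
    show "section_at x (g \<otimes>\<^bsub>automaton_group A\<^esub> h) =
      section_at (x \<noteq> root_swap h) g \<otimes>\<^bsub>automaton_group A\<^esub> section_at x h" for x
      using gh section_at_in_automaton_group *[of x]
      by (simp add: mult_automaton_group fun_eq_iff section_at_def[of x "g \<circ> h"])
  next
    fix S g
    assume S: "S \<subseteq> carrier (automaton_group A)" "\<And>g. g \<in> S \<Longrightarrow> \<not> root_swap g"
      "\<And>g x. g \<in> S \<Longrightarrow> section_at x g \<in> S" and g: "g \<in> S"
    \<comment> \<open>All of \<open>S\<close> is treated at once, because the tail of a word is
      acted on by a section, which is another element of \<open>S\<close>.\<close>
    have "\<forall>g \<in> S. g w = w" for w
    proof (induction w)
      case Nil
      then show ?case using S(1) automaton_group_Nil by blast
    next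
      case (Cons x w)
      show ?case
      proof
        fix g assume g: "g \<in> S"
        then have "g (x # w) = (x \<noteq> root_swap g) # section_at x g w"
          using S(1) automaton_group_Cons by blast
        then show "g (x # w) = x # w" using S(2,3)[OF g] Cons by simp
      qed
    qed
    then show "g = \<one>\<^bsub>automaton_group A\<^esub>" using g by (auto simp: one_automaton_group)
  qed
qed

theorem commutative_automaton_group_classification:
  assumes "comm_group (automaton_group A)"
  shows "automaton_group A \<cong> integer_mod_group 2 \<times>\<times> integer_mod_group 2 \<times>\<times> integer_mod_group 2
    \<or> automaton_group A \<cong> integer_mod_group 2 \<times>\<times> integer_mod_group 2
    \<or> automaton_group A \<cong> integer_mod_group 2
    \<or> automaton_group A \<cong> integer_group \<times>\<times> integer_group
    \<or> automaton_group A \<cong> integer_group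
    \<or> carrier (automaton_group A) = {\<one>\<^bsub>automaton_group A\<^esub>}"
proof -
  interpret self_similar_comm_group "automaton_group A" root_swap section_at
    by (rule self_similar_automaton_group) fact
  show ?thesis
    by (rule classification[of "act A" "next0 A" "next1 A"])
      (simp_all add: automaton_group_generated_by_states assms)
qed

section \<open>The six abelian groups\<close>

lemma numbered_automaton_eqI: "automaton_number A = n \<Longrightarrow> numbered_automaton n = A"
  unfolding numbered_automaton_def by (rule the_equality) (auto dest: injD[OF inj_automaton_number])

definition automaton_of :: "bool \<times> state \<times> state \<Rightarrow> bool \<times> state \<times> state \<Rightarrow> bool \<times> state \<times> state \<Rightarrow> automaton" where
  "automaton_of a b c = case_state a b c"

lemma automaton_of_simps:
  assumes "A = automaton_of a b c"
  shows "swaps A S1 = fst a" "next0 A S1 = fst (snd a)" "next1 A S1 = snd (snd a)"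
    "swaps A S2 = fst b" "next0 A S2 = fst (snd b)" "next1 A S2 = snd (snd b)"
    "swaps A S3 = fst c" "next0 A S3 = fst (snd c)" "next1 A S3 = snd (snd c)"
  by (simp_all add: assms automaton_of_def swaps_def next0_def next1_def)

text \<open>The successors are the ternary digits of \<open>n - 1\<close> below 729, and the swaps
  are the bits above. For instance 770 is 729 + 41 with 41 = 2 + 3 + 9 + 27.\<close>

lemma numbered_automata:
  "numbered_automaton 1 = automaton_of (False, S1, S1) (False, S1, S1) (False, S1, S1)"
  "numbered_automaton 1090 = automaton_of (True, S1, S1) (False, S2, S2) (False, S2, S2)"
  "numbered_automaton 730 = automaton_of (True, S1, S1) (False, S1, S1) (False, S1, S1)"
  "numbered_automaton 802 = automaton_of (True, S1, S1) (False, S3, S3) (False, S1, S1)"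
  "numbered_automaton 731 = automaton_of (True, S2, S1) (False, S1, S1) (False, S1, S1)"
  "numbered_automaton 771 = automaton_of (True, S3, S2) (False, S2, S2) (False, S1, S1)"
  by (rule numbered_automaton_eqI, simp add: automaton_number_def automaton_of_simps[OF refl])+

lemma iso_singleton_group:
  assumes "group G" "carrier G = {\<one>\<^bsub>G\<^esub>}"
  shows "G \<cong> singleton_group ()"
proof -
  have "(\<lambda>_. ()) \<in> iso G (singleton_group ())"
    using assms(2) by (auto simp: iso_def hom_def bij_betw_def singleton_group_def)
  then show ?thesis by (rule is_isoI)
qed

lemma automaton_group_1: "automaton_group (numbered_automaton 1) \<cong> singleton_group ()"
proof -
  define A where "A = numbered_automaton 1"
  note A = automaton_of_simps[OF A_def[unfolded numbered_automata]]
  have act: "act A q w = w" for q w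
  proof (induction w arbitrary: q)
    case (Cons x w)
    then show ?case by (cases q) (simp_all add: act_Cons A)
  qed simp
  interpret G: group "automaton_group A" by (rule group_automaton_group)
  have "carrier (automaton_group A) = carrier (subgroup_generated (automaton_group A) (range (act A)))"
    by (simp add: automaton_group_def group.subgroup_generated2 group_tree_Aut)
  also have "\<dots> \<subseteq> {\<one>\<^bsub>automaton_group A\<^esub>}"
    by (rule G.subgroup_generated_minimal[OF G.triv_subgroup])
      (auto simp: one_automaton_group act fun_eq_iff)
  finally have "carrier (automaton_group A) = {\<one>\<^bsub>automaton_group A\<^esub>}"
    using G.one_closed by blast
  then show ?thesis using iso_singleton_group[OF G.is_group] by (simp add: A_def)
qed

text \<open>\<open>S1\<close> flips every letter, while \<open>S2\<close> only loops without
  swapping, which makes \<open>S2\<close> and \<open>S3\<close> trivial.\<close>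

lemma automaton_group_1090: "automaton_group (numbered_automaton 1090) \<cong> integer_mod_group 2"
proof -
  define A where "A = numbered_automaton 1090"
  note A = automaton_of_simps[OF A_def[unfolded numbered_automata]]
  have b: "act A S2 w = w" for w
    by (induction w) (simp_all add: act_Cons A)
  have c: "act A S3 w = w" for w
    using b by (cases w) (simp_all add: act_Cons A)
  have aa: "act A S1 (act A S1 w) = w" for w
    by (induction w) (auto simp: act_Cons A)
  have "act A p (act A q w) = act A q (act A p w)" for p q w
    by (cases p; cases q) (simp_all add: b c)
  then have comm: "comm_group (automaton_group A)" by (rule comm_group_automaton_group)
  interpret self_similar_comm_group "automaton_group A" root_swap section_at
    by (rule self_similar_automaton_group) fact
  have bc: "act A S2 = \<one>\<^bsub>automaton_group A\<^esub>" "act A S3 = \<one>\<^bsub>automaton_group A\<^esub>"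
    using b c by (simp_all add: one_automaton_group fun_eq_iff)
  have "automaton_group A \<cong> integer_mod_group 2"
  proof (rule iso_integer_mod_group_1[of "act A S1"])
    show "act A S1 [^]\<^bsub>automaton_group A\<^esub> int 2 = \<one>\<^bsub>automaton_group A\<^esub>"
      using act_int_pow_2 aa by simp
    show "\<forall>g \<in> carrier (automaton_group A). \<exists>i::int. g = act A S1 [^]\<^bsub>automaton_group A\<^esub> i"
      using automaton_group_generated_by_states[OF comm] by (auto simp: bc)
    show "int 2 dvd i" if "act A S1 [^]\<^bsub>automaton_group A\<^esub> i = \<one>\<^bsub>automaton_group A\<^esub>" for i
      using P_int_pow[of "act A S1" i] that by (simp add: A)
  qed simp
  then show ?thesis by (simp add: A_def)
qed

text \<open>\<open>a\<close> flips every letter, and \<open>b\<close> every letter but the first.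
  The parity of the exponent of \<open>a\<close> shows at the root, that of \<open>b\<close> one
  level below.\<close>

lemma automaton_group_730:
  "automaton_group (numbered_automaton 730) \<cong> integer_mod_group 2 \<times>\<times> integer_mod_group 2"
proof -
  define A where "A = numbered_automaton 730"
  note A = automaton_of_simps[OF A_def[unfolded numbered_automata]]
  define G where "G = automaton_group A"
  define a where "a = act A S1"
  define b where "b = act A S2"
  have c: "act A S3 = b"
    unfolding b_def
  proof
    show "act A S3 w = act A S2 w" for w by (cases w) (simp_all add: act_Cons A)
  qed
  have aa: "act A S1 (act A S1 w) = w" for w
    by (induction w) (auto simp: act_Cons A)
  have bb: "act A S2 (act A S2 w) = w" for w
    by (cases w) (auto simp: act_Cons A aa)
  have ab: "act A S1 (act A S2 w) = act A S2 (act A S1 w)" for w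
    by (cases w) (simp_all add: act_Cons A)
  have "act A p (act A q w) = act A q (act A p w)" for p q w
    by (cases p; cases q) (simp_all add: ab c b_def)
  then have comm: "comm_group (automaton_group A)" by (rule comm_group_automaton_group)
  interpret self_similar_comm_group G root_swap section_at
    unfolding G_def by (rule self_similar_automaton_group) fact
  have carr: "a \<in> carrier G" "b \<in> carrier G" by (simp_all add: a_def b_def G_def)
  have swap: "root_swap a" "\<not> root_swap b" and sec_b: "section_at x b = a" for x
    by (simp_all add: a_def b_def A)
  have two: "a [^]\<^bsub>G\<^esub> (2::int) = \<one>\<^bsub>G\<^esub>" "b [^]\<^bsub>G\<^esub> (2::int) = \<one>\<^bsub>G\<^esub>"
    using act_int_pow_2 aa bb by (simp_all add: G_def a_def b_def)
  have "G \<cong> integer_mod_group 2 \<times>\<times> integer_mod_group 2"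
  proof (rule iso_integer_mod_group_2[OF carr])
    show "\<forall>g \<in> carrier G. \<exists>(i::int) (j::int). g = a [^]\<^bsub>G\<^esub> i \<otimes>\<^bsub>G\<^esub> b [^]\<^bsub>G\<^esub> j"
    proof
      fix g assume "g \<in> carrier G"
      then obtain i j k :: int where
        "g = a [^]\<^bsub>G\<^esub> i \<otimes>\<^bsub>G\<^esub> (b [^]\<^bsub>G\<^esub> j \<otimes>\<^bsub>G\<^esub> b [^]\<^bsub>G\<^esub> k)"
        using automaton_group_generated_by_states[OF comm]
        unfolding c a_def[symmetric] b_def[symmetric] G_def[symmetric] by blast
      then have "g = a [^]\<^bsub>G\<^esub> i \<otimes>\<^bsub>G\<^esub> b [^]\<^bsub>G\<^esub> (j + k)"
        using carr by (simp add: int_pow_mult)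
      then show "\<exists>(i::int) (j::int). g = a [^]\<^bsub>G\<^esub> i \<otimes>\<^bsub>G\<^esub> b [^]\<^bsub>G\<^esub> j" by blast
    qed
    fix i j :: int
    assume rel: "a [^]\<^bsub>G\<^esub> i \<otimes>\<^bsub>G\<^esub> b [^]\<^bsub>G\<^esub> j = \<one>\<^bsub>G\<^esub>"
    have "root_swap (a [^]\<^bsub>G\<^esub> i \<otimes>\<^bsub>G\<^esub> b [^]\<^bsub>G\<^esub> j) \<longleftrightarrow> odd i"
      using carr swap by (simp add: P_int_pow)
    then have i: "even i" by (simp add: rel)
    then have "a [^]\<^bsub>G\<^esub> i = \<one>\<^bsub>G\<^esub>"
      using int_pow_mod_exponent[OF carr(1) two(1), of i] by simp
    then have "b [^]\<^bsub>G\<^esub> j = \<one>\<^bsub>G\<^esub>" using rel carr by simp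
    then have "a [^]\<^bsub>G\<^esub> j = \<one>\<^bsub>G\<^esub>" using sec_int_pow[of b False j] carr swap by (simp add: sec_b)
    then have "even j" using P_int_pow[of a j] carr swap by simp
    then show "int 2 dvd i \<and> int 2 dvd j" using i by simp
  qed (use two in simp_all)
  then show ?thesis by (simp add: A_def G_def)
qed

text \<open>\<open>a\<close>, \<open>c\<close> and \<open>b\<close> flip all letters from the first,
  second and third on, respectively. Their exponents are therefore detected modulo 2 on three
  successive levels.\<close>

lemma automaton_group_802:
  "automaton_group (numbered_automaton 802)
    \<cong> integer_mod_group 2 \<times>\<times> integer_mod_group 2 \<times>\<times> integer_mod_group 2"
proof -
  define A where "A = numbered_automaton 802"
  note A = automaton_of_simps[OF A_def[unfolded numbered_automata]]
  define G where "G = automaton_group A"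
  define a where "a = act A S1"
  define b where "b = act A S2"
  define c where "c = act A S3"
  have aa: "act A S1 (act A S1 w) = w" for w
    by (induction w) (auto simp: act_Cons A)
  have cc: "act A S3 (act A S3 w) = w" for w
    by (cases w) (auto simp: act_Cons A aa)
  have bb: "act A S2 (act A S2 w) = w" for w
    by (cases w) (auto simp: act_Cons A cc)
  have ac: "act A S1 (act A S3 w) = act A S3 (act A S1 w)" for w
    by (cases w) (simp_all add: act_Cons A)
  have ab: "act A S1 (act A S2 w) = act A S2 (act A S1 w)" for w
    by (cases w) (simp_all add: act_Cons A ac)
  have bc: "act A S2 (act A S3 w) = act A S3 (act A S2 w)" for w
    by (cases w) (simp_all add: act_Cons A ac)
  have "act A p (act A q w) = act A q (act A p w)" for p q w
    by (cases p; cases q) (simp_all add: ab ac bc)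
  then have comm: "comm_group (automaton_group A)" by (rule comm_group_automaton_group)
  interpret self_similar_comm_group G root_swap section_at
    unfolding G_def by (rule self_similar_automaton_group) fact
  have carr: "a \<in> carrier G" "b \<in> carrier G" "c \<in> carrier G"
    by (simp_all add: a_def b_def c_def G_def)
  have swap: "root_swap a" "\<not> root_swap b" "\<not> root_swap c"
    and sec_b: "section_at x b = c" and sec_c: "section_at x c = a" for x
    by (simp_all add: a_def b_def c_def A)
  have two: "a [^]\<^bsub>G\<^esub> (2::int) = \<one>\<^bsub>G\<^esub>" "b [^]\<^bsub>G\<^esub> (2::int) = \<one>\<^bsub>G\<^esub>" "c [^]\<^bsub>G\<^esub> (2::int) = \<one>\<^bsub>G\<^esub>"
    using act_int_pow_2 aa bb cc by (simp_all add: G_def a_def b_def c_def)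
  \<comment> \<open>This strips off the power of \<open>a\<close>. It is used at the root and again
    for the section, where \<open>a\<close> replaces \<open>c\<close> and \<open>c\<close> replaces
    \<open>b\<close>.\<close>
  have even: "even i \<and> a [^]\<^bsub>G\<^esub> i = \<one>\<^bsub>G\<^esub> \<and> g = \<one>\<^bsub>G\<^esub>"
    if "a [^]\<^bsub>G\<^esub> i \<otimes>\<^bsub>G\<^esub> g = \<one>\<^bsub>G\<^esub>" "g \<in> carrier G" "\<not> root_swap g" for i :: int and g
  proof -
    have "root_swap (a [^]\<^bsub>G\<^esub> i \<otimes>\<^bsub>G\<^esub> g) \<longleftrightarrow> odd i"
      using carr swap that(2,3) by (simp add: P_int_pow)
    then have i: "even i" by (simp add: that)
    then have "a [^]\<^bsub>G\<^esub> i = \<one>\<^bsub>G\<^esub>"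
      using int_pow_mod_exponent[OF carr(1) two(1), of i] by simp
    with i that show ?thesis by simp
  qed
  have "G \<cong> integer_mod_group 2 \<times>\<times> integer_mod_group 2 \<times>\<times> integer_mod_group 2"
  proof (rule iso_integer_mod_group_3[OF carr])
    show "\<forall>g \<in> carrier G. \<exists>(i::int) (j::int) (k::int).
        g = a [^]\<^bsub>G\<^esub> i \<otimes>\<^bsub>G\<^esub> (b [^]\<^bsub>G\<^esub> j \<otimes>\<^bsub>G\<^esub> c [^]\<^bsub>G\<^esub> k)"
      using automaton_group_generated_by_states[OF comm]
      unfolding a_def[symmetric] b_def[symmetric] c_def[symmetric] G_def[symmetric] .
    fix i j k :: int
    assume rel: "a [^]\<^bsub>G\<^esub> i \<otimes>\<^bsub>G\<^esub> (b [^]\<^bsub>G\<^esub> j \<otimes>\<^bsub>G\<^esub> c [^]\<^bsub>G\<^esub> k) = \<one>\<^bsub>G\<^esub>"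
    then have i: "even i" and bc: "b [^]\<^bsub>G\<^esub> j \<otimes>\<^bsub>G\<^esub> c [^]\<^bsub>G\<^esub> k = \<one>\<^bsub>G\<^esub>"
      using even[OF rel] carr swap by (simp_all add: P_int_pow)
    have "section_at False (b [^]\<^bsub>G\<^esub> j \<otimes>\<^bsub>G\<^esub> c [^]\<^bsub>G\<^esub> k) = a [^]\<^bsub>G\<^esub> k \<otimes>\<^bsub>G\<^esub> c [^]\<^bsub>G\<^esub> j"
      using carr swap by (simp add: sec_mult sec_int_pow P_int_pow sec_b sec_c m_comm)
    then have "a [^]\<^bsub>G\<^esub> k \<otimes>\<^bsub>G\<^esub> c [^]\<^bsub>G\<^esub> j = \<one>\<^bsub>G\<^esub>" by (simp add: bc)
    then have k: "even k" and c: "c [^]\<^bsub>G\<^esub> j = \<one>\<^bsub>G\<^esub>"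
      using even[of k "c [^]\<^bsub>G\<^esub> j"] carr swap by (simp_all add: P_int_pow)
    have "a [^]\<^bsub>G\<^esub> j = \<one>\<^bsub>G\<^esub>" using c sec_int_pow[of c False j] carr swap by (simp add: sec_c)
    then have "even j" using P_int_pow[of a j] carr swap by simp
    then show "int 2 dvd i \<and> int 2 dvd j \<and> int 2 dvd k" using i k by simp
  qed (use two in simp_all)
  then show ?thesis by (simp add: A_def G_def)
qed

text \<open>The states \<open>S2\<close> and \<open>S3\<close> both act as the inverse square of
  \<open>a\<close>, so the group is cyclic, and the dichotomy shows that it is infinite.\<close>

lemma automaton_group_731: "automaton_group (numbered_automaton 731) \<cong> integer_group"
proof -
  define A where "A = numbered_automaton 731"
  note A = automaton_of_simps[OF A_def[unfolded numbered_automata]]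
  define G where "G = automaton_group A"
  define a where "a = act A S1"
  define b where "b = act A S2"
  have c: "act A S3 = b"
    unfolding b_def
  proof
    show "act A S3 w = act A S2 w" for w by (cases w) (simp_all add: act_Cons A)
  qed
  \<comment> \<open>The three cyclic rotations must be proved together, since the sections of each
    of these products are again among them.\<close>
  have aab: "act A S1 (act A S1 (act A S2 w)) = w \<and> act A S1 (act A S2 (act A S1 w)) = w
      \<and> act A S2 (act A S1 (act A S1 w)) = w" for w
    by (induction w) (auto simp: act_Cons A)
  then have ab: "act A S1 (act A S2 w) = act A S2 (act A S1 w)" for w
    by (metis inj_act)
  have "act A p (act A q w) = act A q (act A p w)" for p q w
    by (cases p; cases q) (simp_all add: ab c b_def)
  then have comm: "comm_group (automaton_group A)" by (rule comm_group_automaton_group)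
  interpret self_similar_comm_group G root_swap section_at
    unfolding G_def by (rule self_similar_automaton_group) fact
  have carr: "a \<in> carrier G" "b \<in> carrier G" by (simp_all add: a_def b_def G_def)
  have "b \<otimes>\<^bsub>G\<^esub> (a \<otimes>\<^bsub>G\<^esub> a) = b \<circ> (a \<otimes>\<^bsub>G\<^esub> a)"
    using carr m_closed[of a a] unfolding G_def by (intro mult_automaton_group)
  also have "\<dots> = b \<circ> (a \<circ> a)"
    using carr unfolding G_def by (simp add: mult_automaton_group)
  also have "\<dots> = \<one>\<^bsub>G\<^esub>"
    using aab by (simp add: a_def b_def G_def one_automaton_group fun_eq_iff)
  finally have "b \<otimes>\<^bsub>G\<^esub> (a \<otimes>\<^bsub>G\<^esub> a) = \<one>\<^bsub>G\<^esub>" .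
  then have "b = inv\<^bsub>G\<^esub> (a [^]\<^bsub>G\<^esub> (2::int))"
    using int_pow_mult[of a 1 1] inv_equality carr by simp
  then have b: "b = a [^]\<^bsub>G\<^esub> (- 2 :: int)" using carr by (simp only: int_pow_neg)
  \<comment> \<open>This excludes the exponent 2 branch of the dichotomy; a word of length two is
    enough to see it.\<close>
  have "a \<otimes>\<^bsub>G\<^esub> a \<noteq> \<one>\<^bsub>G\<^esub>"
  proof
    assume "a \<otimes>\<^bsub>G\<^esub> a = \<one>\<^bsub>G\<^esub>"
    then have "(a \<circ> a) [False, False] = [False, False]"
      using carr by (simp add: G_def mult_automaton_group one_automaton_group)
    then show False by (simp add: a_def act_Cons A)
  qed
  then have torsion_free: "\<And>g k. g \<in> carrier G \<Longrightarrow> g [^]\<^bsub>G\<^esub> (k::int) = \<one>\<^bsub>G\<^esub> \<Longrightarrow> k \<noteq> 0 \<Longrightarrow> g = \<one>\<^bsub>G\<^esub>"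
    using exponent_2_or_torsion_free carr by metis
  have "G \<cong> integer_mod_group 0"
  proof (rule iso_integer_mod_group_1[OF carr(1)])
    show "\<forall>g \<in> carrier G. \<exists>i::int. g = a [^]\<^bsub>G\<^esub> i"
    proof
      fix g assume "g \<in> carrier G"
      then obtain i j k :: int where
        "g = a [^]\<^bsub>G\<^esub> i \<otimes>\<^bsub>G\<^esub> (b [^]\<^bsub>G\<^esub> j \<otimes>\<^bsub>G\<^esub> b [^]\<^bsub>G\<^esub> k)"
        using automaton_group_generated_by_states[OF comm]
        unfolding c a_def[symmetric] b_def[symmetric] G_def[symmetric] by blast
      then have "g = a [^]\<^bsub>G\<^esub> (i + (- 2 * j + - 2 * k))"
        using carr by (simp only: b int_pow_pow int_pow_mult int_pow_closed)
      then show "\<exists>i::int. g = a [^]\<^bsub>G\<^esub> i" by blast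
    qed
    show "int 0 dvd i" if "a [^]\<^bsub>G\<^esub> i = \<one>\<^bsub>G\<^esub>" for i
    proof -
      have "root_swap a" by (simp add: a_def A)
      then have "a \<noteq> \<one>\<^bsub>G\<^esub>" using P_one by auto
      then show ?thesis using torsion_free[OF carr(1) that] by auto
    qed
  qed simp
  then show ?thesis by (simp add: A_def G_def integer_mod_group_def)
qed

text \<open>\<open>S2\<close> is trivial, so both sections of the square of \<open>a\<close> are
  \<open>c\<close>, and both sections of \<open>c\<close> are \<open>a\<close>. A relation with
  exponents \<open>(i, k)\<close> thus forces \<open>i\<close> to be even and yields one with
  exponents \<open>(k, i div 2)\<close>; infinite descent gives independence.\<close>

lemma automaton_group_771:
  "automaton_group (numbered_automaton 771) \<cong> integer_group \<times>\<times> integer_group"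
proof -
  define A where "A = numbered_automaton 771"
  note A = automaton_of_simps[OF A_def[unfolded numbered_automata]]
  define G where "G = automaton_group A"
  define a where "a = act A S1"
  define c where "c = act A S3"
  have b: "act A S2 w = w" for w
    by (induction w) (simp_all add: act_Cons A)
  have ac: "act A S1 (act A S3 w) = act A S3 (act A S1 w)" for w
    by (induction w) (auto simp: act_Cons A b)
  have "act A p (act A q w) = act A q (act A p w)" for p q w
    by (cases p; cases q) (simp_all add: b ac)
  then have comm: "comm_group (automaton_group A)" by (rule comm_group_automaton_group)
  interpret self_similar_comm_group G root_swap section_at
    unfolding G_def by (rule self_similar_automaton_group) fact
  have carr: "a \<in> carrier G" "c \<in> carrier G" by (simp_all add: a_def c_def G_def)
  have b_one: "act A S2 = \<one>\<^bsub>G\<^esub>"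
    using b by (simp add: G_def one_automaton_group fun_eq_iff)
  have swap: "root_swap a" "\<not> root_swap c"
    and sec_a: "section_at False a = c" "section_at True a = \<one>\<^bsub>G\<^esub>" and sec_c: "section_at x c = a" for x
    by (simp_all add: a_def c_def A b_one)
  have descent: "even i \<and> a [^]\<^bsub>G\<^esub> k \<otimes>\<^bsub>G\<^esub> c [^]\<^bsub>G\<^esub> (i div 2) = \<one>\<^bsub>G\<^esub>"
    if rel: "a [^]\<^bsub>G\<^esub> i \<otimes>\<^bsub>G\<^esub> c [^]\<^bsub>G\<^esub> k = \<one>\<^bsub>G\<^esub>" for i k :: int
  proof -
    have "root_swap (a [^]\<^bsub>G\<^esub> i \<otimes>\<^bsub>G\<^esub> c [^]\<^bsub>G\<^esub> k) \<longleftrightarrow> odd i"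
      using carr swap by (simp add: P_int_pow)
    then have i: "even i" by (simp add: rel)
    then obtain l where l: "i = 2 * l" by blast
    have "section_at False (a [^]\<^bsub>G\<^esub> i \<otimes>\<^bsub>G\<^esub> c [^]\<^bsub>G\<^esub> k) = a [^]\<^bsub>G\<^esub> k \<otimes>\<^bsub>G\<^esub> c [^]\<^bsub>G\<^esub> l"
      unfolding l using carr swap
      by (simp add: sec_mult sec_int_pow[of c] sec_int_pow_double P_int_pow sec_a sec_c m_comm)
    then show ?thesis using i l by (simp add: rel[unfolded l])
  qed
  have independent: "i = 0 \<and> k = 0" if "a [^]\<^bsub>G\<^esub> i \<otimes>\<^bsub>G\<^esub> c [^]\<^bsub>G\<^esub> k = \<one>\<^bsub>G\<^esub>" for i k :: int
    using that
  \<comment> \<open>With \<open>i = 2 * l\<close>, weights \<open>p\<close> and \<open>q\<close>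
    make the measure drop from \<open>2 * p * \<bar>l\<bar> + q * \<bar>k\<bar>\<close> to
    \<open>p * \<bar>k\<bar> + q * \<bar>l\<bar>\<close>. This needs \<open>p < q < 2 * p\<close>,
    and 2 and 3 are the least such integers.\<close>
  proof (induction "2 * nat \<bar>i\<bar> + 3 * nat \<bar>k\<bar>" arbitrary: i k rule: less_induct)
    case less
    obtain l where l: "i = 2 * l" using descent[OF less.prems] by blast
    have rel: "a [^]\<^bsub>G\<^esub> k \<otimes>\<^bsub>G\<^esub> c [^]\<^bsub>G\<^esub> l = \<one>\<^bsub>G\<^esub>" using descent[OF less.prems] l by simp
    show ?case
    proof (rule ccontr)
      assume "\<not> (i = 0 \<and> k = 0)"
      then have "2 * nat \<bar>k\<bar> + 3 * nat \<bar>l\<bar> < 2 * nat \<bar>i\<bar> + 3 * nat \<bar>k\<bar>" using l by auto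
      then have "k = 0 \<and> l = 0" using less.hyps rel by blast
      then show False using l \<open>\<not> (i = 0 \<and> k = 0)\<close> by simp
    qed
  qed
  have "G \<cong> integer_mod_group 0 \<times>\<times> integer_mod_group 0"
  proof (rule iso_integer_mod_group_2[OF carr])
    show "\<forall>g \<in> carrier G. \<exists>(i::int) (j::int). g = a [^]\<^bsub>G\<^esub> i \<otimes>\<^bsub>G\<^esub> c [^]\<^bsub>G\<^esub> j"
    proof
      fix g assume "g \<in> carrier G"
      then obtain i j k :: int where
        "g = a [^]\<^bsub>G\<^esub> i \<otimes>\<^bsub>G\<^esub> (act A S2 [^]\<^bsub>G\<^esub> j \<otimes>\<^bsub>G\<^esub> c [^]\<^bsub>G\<^esub> k)"
        using automaton_group_generated_by_states[OF comm]
        unfolding a_def[symmetric] c_def[symmetric] G_def[symmetric] by blast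
      then have "g = a [^]\<^bsub>G\<^esub> i \<otimes>\<^bsub>G\<^esub> c [^]\<^bsub>G\<^esub> k" using carr by (simp add: b_one)
      then show "\<exists>(i::int) (j::int). g = a [^]\<^bsub>G\<^esub> i \<otimes>\<^bsub>G\<^esub> c [^]\<^bsub>G\<^esub> j" by blast
    qed
    show "int 0 dvd i \<and> int 0 dvd k" if "a [^]\<^bsub>G\<^esub> i \<otimes>\<^bsub>G\<^esub> c [^]\<^bsub>G\<^esub> k = \<one>\<^bsub>G\<^esub>" for i k
      using independent[OF that] by simp
  qed simp_all
  then show ?thesis by (simp add: A_def G_def integer_mod_group_def)
qed

section \<open>Telling the six groups apart and counting them\<close>

lemma integer_group_not_iso_product: "\<not> integer_group \<times>\<times> integer_group \<cong> integer_group"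
proof
  assume "integer_group \<times>\<times> integer_group \<cong> integer_group"
  then obtain f where f: "f \<in> iso (integer_group \<times>\<times> integer_group) integer_group"
    by (auto simp: is_iso_def)
  define H where "H = integer_group \<times>\<times> integer_group"
  interpret group_hom H integer_group f
    using f by (simp add: group_hom_def group_hom_axioms_def DirProd_group H_def iso_def)
  have add: "f (x + x', y + y') = f (x, y) + f (x', y')" for x x' y y'
    using hom_mult[of "(x, y)" "(x', y')"] by (simp add: H_def)
  have inj: "inj f" using f by (simp add: iso_def bij_betw_def)
  have zero: "f (0, 0) = 0" using add[of 0 0 0 0] by simp
  have fst: "f (int n, 0) = int n * f (1, 0)" and snd: "f (0, int n) = int n * f (0, 1)" for n
    by (induction n) (use add[of 1 "int _" 0 0] add[of 0 0 1 "int _"] zero in \<open>simp_all add: algebra_simps\<close>)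
  define p where "p = f (1, 0)"
  define q where "q = f (0, 1)"
  have neg: "f (- x, - y) = - f (x, y)" for x y
    using add[of "- x" x "- y" y] zero by simp
  have fst': "f (n, 0) = n * p" for n
    by (cases n) (use fst neg[of _ 0] in \<open>auto simp: p_def simp del: of_nat_Suc\<close>)
  have snd': "f (0, n) = n * q" for n
    by (cases n) (use snd neg[of 0] in \<open>auto simp: q_def simp del: of_nat_Suc\<close>)
  \<comment> \<open>Both sides are \<open>p * q\<close>; any two integers \<open>p\<close> and
    \<open>q\<close> satisfy such a relation, so injectivity fails.\<close>
  have "f (q, 0) = f (0, p)" by (simp add: fst' snd')
  then have "q = 0" using inj by (auto dest: injD)
  then have "f (0, 1) = f (0, 0)" using zero by (simp add: q_def)
  then show False using inj by (auto dest: injD)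
qed

lemma DirProd_comm_group:
  assumes "comm_group G" "comm_group H"
  shows "comm_group (G \<times>\<times> H)"
proof (rule group.group_comm_groupI)
  show "group (G \<times>\<times> H)"
    using assms by (intro DirProd_group comm_group.axioms(2))
qed (use assms in \<open>auto intro: comm_groupE(4)\<close>)

lemma comm_group_if_iso:
  assumes "G \<cong> H" "comm_group H" "group G"
  shows "comm_group G"
  using comm_group.iso_imp_comm_group[OF assms(2) group.iso_sym[OF assms(3,1)]] assms(3)
  by (simp add: group.is_monoid)

theorem theorem3:
  shows "card ({A. comm_group (automaton_group A)} // isomorphic_group_rel) = 6
    \<and> (\<forall>A. comm_group (automaton_group A) \<longrightarrow>
         (\<exists>n \<in> {1, 1090, 730, 802, 731, 771}.
            automaton_group A \<cong> automaton_group (numbered_automaton n)))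
    \<and> automaton_group (numbered_automaton 1) \<cong> singleton_group ()
    \<and> automaton_group (numbered_automaton 1090) \<cong> integer_mod_group 2
    \<and> automaton_group (numbered_automaton 730) \<cong> integer_mod_group 2 \<times>\<times> integer_mod_group 2
    \<and> automaton_group (numbered_automaton 802)
        \<cong> integer_mod_group 2 \<times>\<times> integer_mod_group 2 \<times>\<times> integer_mod_group 2
    \<and> automaton_group (numbered_automaton 731) \<cong> integer_group
    \<and> automaton_group (numbered_automaton 771) \<cong> integer_group \<times>\<times> integer_group"
proof -
  let ?G = "\<lambda>n. automaton_group (numbered_automaton n)"
  define N :: "nat set" where "N = {1, 1090, 730, 802, 731, 771}"
  note isos = automaton_group_1 automaton_group_1090 automaton_group_730 automaton_group_802
    automaton_group_731 automaton_group_771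
  have sym: "automaton_group A \<cong> H \<Longrightarrow> H \<cong> automaton_group A" for A and H :: "('b, 'c) monoid_scheme"
    by (rule group.iso_sym[OF group_automaton_group])
  have covered: "\<exists>n \<in> N. automaton_group A \<cong> ?G n" if comm: "comm_group (automaton_group A)" for A
    using commutative_automaton_group_classification[OF comm]
  proof (elim disjE)
    assume "carrier (automaton_group A) = {\<one>\<^bsub>automaton_group A\<^esub>}"
    from iso_trans[OF iso_singleton_group[OF group_automaton_group this] sym[OF automaton_group_1]]
    show ?thesis by (auto simp: N_def)
  qed (auto simp: N_def dest: iso_trans[OF _ sym[OF automaton_group_1090]]
      iso_trans[OF _ sym[OF automaton_group_730]] iso_trans[OF _ sym[OF automaton_group_802]]
      iso_trans[OF _ sym[OF automaton_group_731]] iso_trans[OF _ sym[OF automaton_group_771]])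
  have comm: "comm_group (?G n)" if "n \<in> N" for n
  proof -
    have "comm_group (singleton_group ())" "comm_group (integer_mod_group 2)"
      "comm_group (integer_mod_group 2 \<times>\<times> integer_mod_group 2)"
      "comm_group (integer_mod_group 2 \<times>\<times> integer_mod_group 2 \<times>\<times> integer_mod_group 2)"
      "comm_group integer_group" "comm_group (integer_group \<times>\<times> integer_group)"
      by (simp_all add: DirProd_comm_group abelian_integer_group)
    then show ?thesis
      using that isos[THEN comm_group_if_iso[OF _ _ group_automaton_group]] unfolding N_def by auto
  qed
  have distinct: "m = n" if "m \<in> N" "n \<in> N" and iso: "?G m \<cong> ?G n" for m n
  proof -
    \<comment> \<open>The value 0 is the default of \<open>card\<close> for infinite sets. It
      separates the two infinite groups from the finite ones, but not from each other.\<close>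
    have cards: "card (carrier (?G 1)) = 1" "card (carrier (?G 1090)) = 2" "card (carrier (?G 730)) = 4"
      "card (carrier (?G 802)) = 8" "card (carrier (?G 731)) = 0" "card (carrier (?G 771)) = 0"
      using isos[THEN iso_same_card]
      by (simp_all add: carrier_integer_mod_group card_cartesian_product infinite_UNIV_int finite_prod)
    have "\<not> ?G 731 \<cong> ?G 771" "\<not> ?G 771 \<cong> ?G 731"
      using integer_group_not_iso_product
        iso_trans[OF iso_trans[OF sym[OF automaton_group_771] sym] automaton_group_731]
        iso_trans[OF iso_trans[OF sym[OF automaton_group_771]] automaton_group_731] by auto
    then show ?thesis
      using that iso_same_card[OF iso] cards unfolding N_def by auto
  qed
  have rel: "(A, B) \<in> isomorphic_group_rel \<longleftrightarrow> automaton_group A \<cong> automaton_group B" for A B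
    by (simp add: isomorphic_group_rel_def)
  have "equiv UNIV isomorphic_group_rel"
    by (auto simp: equiv_def refl_on_def sym_def trans_def rel iso_refl intro: sym iso_trans)
  then have class_eq: "isomorphic_group_rel `` {A} = isomorphic_group_rel `` {B}
      \<longleftrightarrow> automaton_group A \<cong> automaton_group B" for A B
    by (simp add: eq_equiv_class_iff rel)
  \<comment> \<open>The six numbers are a system of representatives: \<open>distinct\<close> gives
    injectivity, \<open>comm\<close> that the classes lie in the quotient, and
    \<open>covered\<close> that every class is hit.\<close>
  have "bij_betw (\<lambda>n. isomorphic_group_rel `` {numbered_automaton n}) N
      ({A. comm_group (automaton_group A)} // isomorphic_group_rel)"
    unfolding bij_betw_def
  proof
    show "inj_on (\<lambda>n. isomorphic_group_rel `` {numbered_automaton n}) N"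
      by (rule inj_onI) (simp add: class_eq distinct)
    show "(\<lambda>n. isomorphic_group_rel `` {numbered_automaton n}) ` N
        = {A. comm_group (automaton_group A)} // isomorphic_group_rel"
    proof
      show "(\<lambda>n. isomorphic_group_rel `` {numbered_automaton n}) ` N
          \<subseteq> {A. comm_group (automaton_group A)} // isomorphic_group_rel"
        using comm by (auto intro: quotientI)
      show "{A. comm_group (automaton_group A)} // isomorphic_group_rel
          \<subseteq> (\<lambda>n. isomorphic_group_rel `` {numbered_automaton n}) ` N"
        using covered class_eq by (auto simp: quotient_def image_iff)
    qed
  qed
  then have "card ({A. comm_group (automaton_group A)} // isomorphic_group_rel) = card N"
    by (metis bij_betw_same_card)
  then show ?thesis using covered isos unfolding N_def by simp
qed

end
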